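(* Let $p\in\mathbb{N}$ and let $m$ be an integer with $0\le m\le p$. Let $f(z)=\sum_{k=0}^{\infty}a_{pk+m}z^{pk+m}$ be analytic in $\mathbb{D}$ and $|f(z)|\le 1$ in $\mathbb{D}$. Then $$M_f(r)\le 1\quad\text{for } r\le r_{p,m},$$ where $r_{p,m}$ is the maximal positive root of the equation $$-6r^{p-m}+r^{2(p-m)}+8r^{2p}+1=0.$$ The extremal function has the form $z^m(z^p-a)/(1-az^p)$, where $$a=\left(1-\frac{\sqrt{1-r_{p,m}^{2p}}}{\sqrt{2}}\right)\frac{1}{r_{p,m}^{p}}.$$
   Context: $\mathbb{D}=\{z\in\mathbb{C}:|z|<1\}$ is the open unit disk. For a power series $f(z)=\sum_{k=0}^\infty c_kz^k$ convergent in $\mathbb{D}$, its majorant series is $M_f(r)=\sum_{k=0}^{\infty}|c_k|r^k$, where $r=|z|$; for $f$ as in the claim, $M_f(r)=\sum_{k=0}^{\infty}|a_{pk+m}|r^{pk+m}$. The Bohr radius of a function $f$ is the largest $r\le 1$ up to which $M_f\le 1$ holds. A function of the class considered is called extremal if its Bohr radius equals $r_{p,m}$.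
   Formalization: That z^m(z^p-a)/(1-az^p) is extremal is claimed only for m≥1: for m=0 one gets a=1 and the function is the constant -1, with Bohr radius 1, not r_{p,0}=3^{-1/p}. That every extremal function has this form is stated up to rotations cf(dz), |c|=|d|=1. p≥1. *)

theory Defs
  imports "HOL-Complex_Analysis.Complex_Analysis"
begin

(* The suminf is only meaningful where the series converges. For f holomorphic on the unit disk
   that includes every 0 \<le> r < 1, and below only such r are used. *)
definition majorant :: "(complex \<Rightarrow> complex) \<Rightarrow> real \<Rightarrow> real" where
  "majorant f r = (\<Sum>k. norm (fps_nth (fps_expansion f 0) k) * r ^ k)"

(* The maximum exists: the set contains 0 and is closed under suprema, because
   the radius r itself is left out of the inner condition. Including it would
   change nothing for r < 1, where the majorant is continuous. *)
definition bohr_radius :: "(complex \<Rightarrow> complex) \<Rightarrow> real" where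
  "bohr_radius f = (GREATEST r. 0 \<le> r \<and> r \<le> 1 \<and> (\<forall>\<rho>. 0 \<le> \<rho> \<and> \<rho> < r \<longrightarrow> majorant f \<rho> \<le> 1))"

definition bohr_class :: "nat \<Rightarrow> nat \<Rightarrow> (complex \<Rightarrow> complex) set" where
  "bohr_class p m = {f. f holomorphic_on ball 0 1 \<and> (\<forall>z\<in>ball 0 1. norm (f z) \<le> 1) \<and>
     (\<exists>a :: nat \<Rightarrow> complex. \<forall>z\<in>ball 0 1. (\<lambda>k. a (p * k + m) * z ^ (p * k + m)) sums f z)}"

definition bohr_root_eq :: "nat \<Rightarrow> nat \<Rightarrow> real \<Rightarrow> bool" where
  "bohr_root_eq p m r \<longleftrightarrow> - 6 * r ^ (p - m) + r ^ (2 * (p - m)) + 8 * r ^ (2 * p) + 1 = 0"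

definition bohr_root :: "nat \<Rightarrow> nat \<Rightarrow> real" where
  "bohr_root p m = (GREATEST r. 0 < r \<and> bohr_root_eq p m r)"

definition extremal_param :: "nat \<Rightarrow> nat \<Rightarrow> real" where
  "extremal_param p m =
     (1 - sqrt (1 - bohr_root p m ^ (2 * p)) / sqrt 2) * (1 / bohr_root p m ^ p)"

definition extremal_fun :: "nat \<Rightarrow> nat \<Rightarrow> complex \<Rightarrow> complex" where
  "extremal_fun p m z = z ^ m * (z ^ p - of_real (extremal_param p m)) /
     (1 - of_real (extremal_param p m) * z ^ p)"

definition extremal :: "nat \<Rightarrow> nat \<Rightarrow> (complex \<Rightarrow> complex) \<Rightarrow> bool" where
  "extremal p m f \<longleftrightarrow> f \<in> bohr_class p m \<and> bohr_radius f = bohr_root p m"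

end

theory Submission
  imports Defs
begin

text \<open>
  Write \<open>f z = z ^ m * g (z ^ p)\<close> with \<open>g z = (\<Sum>k. b k * z ^ k)\<close>. Since \<open>m \<le> p\<close>, the maximum
  principle shows that \<open>g\<close> is again bounded by one (\<open>lacunary_factor\<close>). With \<open>\<rho> = r ^ p\<close> and
  \<open>s = r ^ (p - m)\<close> the majorant of \<open>f\<close> at \<open>r\<close> is \<open>\<rho> / s\<close> times the sum of \<open>norm (b k) * \<rho> ^ k\<close>,
  and the equation for the radius reads \<open>8 * \<rho>\<^sup>2 = 6 * s - s\<^sup>2 - 1\<close>. So the theorem is the sharp
  estimate of this coefficient sum by \<open>s / \<rho>\<close> under that relation (\<open>coeff_sum_le_bohr\<close>).

  Let \<open>a = norm (b 0)\<close>. Schwarz-Pick at the origin and Parseval on a circle bound the weighted square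
  sums of the remaining coefficients by those of the Moebius map \<open>(z - a) / (1 - a * z)\<close>
  (\<open>weighted_square_sum_le\<close>). A Cauchy-Schwarz argument, written as a termwise inequality of means
  against the coefficients of a Moebius map, turns square sums into sums of absolute values
  (\<open>abs_coeff_sum_le\<close>). For \<open>a \<ge> \<rho>\<close> the outcome is the majorant of that Moebius map, and its
  distance to \<open>s / \<rho>\<close> is a positive multiple of the square of \<open>a * \<rho> - (1 + s) / 4\<close>
  (\<open>moebius_majorant_gap\<close>); the extremal parameter is the zero of this square. For \<open>a < \<rho>\<close> the
  inequality is strict.

  The termwise argument also keeps a square measuring how far the modulus of \<open>b 1\<close> is from
  \<open>1 - a\<^sup>2\<close>. If the Bohr radius of \<open>f\<close> is the root, continuity of the majorant forces equality
  at the root, both squares vanish, and the equality case of Schwarz-Pick makes \<open>g\<close> a Moebius map.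
\<close>

section \<open>Parseval on a circle\<close>

lemma has_integral_cis_multiple:
  fixes n :: int
  shows "((\<lambda>t. cis (2 * pi * of_int n * t)) has_integral (if n = 0 then 1 else 0)) {0..1}"
proof (cases "n = 0")
  case True
  then show ?thesis
    using has_integral_const_real[of "1 :: complex" 0 1] by simp
next
  case False
  define c where "c = \<i> * (2 * pi * of_int n)"
  have c: "c \<noteq> 0"
    using False by (simp add: c_def)
  have "((\<lambda>z. exp (c * z) / c) has_field_derivative exp (c * of_real t)) (at (of_real t))" for t
    using c by (auto intro!: derivative_eq_intros)
  then have "((\<lambda>t. exp (c * of_real t) / c) has_vector_derivative exp (c * of_real t))
      (at t within {0..1})" for t
    by (rule has_vector_derivative_real_field)
  then have "((\<lambda>t. exp (c * of_real t)) has_integral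
      exp (c * of_real 1) / c - exp (c * of_real 0) / c) {0..1}"
    by (intro fundamental_theorem_of_calculus) auto
  moreover have "exp (c * of_real t) = cis (2 * pi * of_int n * t)" for t
    by (simp add: c_def cis_conv_exp mult_ac)
  moreover have "exp c = cis (2 * pi * of_int n)"
    by (simp add: c_def cis_conv_exp mult_ac)
  then have "exp c = 1"
    by (simp add: cis_multiple_2pi)
  ultimately show ?thesis
    using False by simp
qed

lemma parseval_finite:
  fixes d :: "nat \<Rightarrow> complex"
  shows "((\<lambda>t. (norm (\<Sum>k<n. d k * cis (2 * pi * t) ^ k))\<^sup>2) has_integral
           (\<Sum>k<n. (norm (d k))\<^sup>2)) {0..1}"
proof -
  have prod: "cis (2 * pi * t) ^ j * cnj (cis (2 * pi * t) ^ k) = cis (2 * pi * of_int (int j - int k) * t)"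
    for j k :: nat and t :: real
  proof -
    have "cis (2 * pi * t) ^ j * cnj (cis (2 * pi * t) ^ k)
        = cis (real j * (2 * pi * t)) * cis (real k * - (2 * pi * t))"
      by (simp only: complex_cnj_power cis_cnj Complex.DeMoivre mult_minus_right)
    then show ?thesis
      by (simp add: cis_mult algebra_simps)
  qed
  have "((\<lambda>t. \<Sum>j<n. \<Sum>k<n. d j * cnj (d k) * cis (2 * pi * of_int (int j - int k) * t))
      has_integral (\<Sum>j<n. \<Sum>k<n. d j * cnj (d k) * (if int j - int k = 0 then 1 else 0))) {0..1}"
    by (intro has_integral_sum has_integral_mult_right has_integral_cis_multiple) auto
  also have "(\<lambda>t. \<Sum>j<n. \<Sum>k<n. d j * cnj (d k) * cis (2 * pi * of_int (int j - int k) * t))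
      = (\<lambda>t. of_real ((norm (\<Sum>k<n. d k * cis (2 * pi * t) ^ k))\<^sup>2))"
  proof
    fix t
    have "(\<Sum>j<n. \<Sum>k<n. d j * cnj (d k) * cis (2 * pi * of_int (int j - int k) * t))
        = (\<Sum>j<n. \<Sum>k<n. (d j * cis (2 * pi * t) ^ j) * cnj (d k * cis (2 * pi * t) ^ k))"
      unfolding prod[symmetric] complex_cnj_mult by (simp only: mult.assoc mult.left_commute)
    then show "(\<Sum>j<n. \<Sum>k<n. d j * cnj (d k) * cis (2 * pi * of_int (int j - int k) * t))
        = of_real ((norm (\<Sum>k<n. d k * cis (2 * pi * t) ^ k))\<^sup>2)"
      unfolding complex_norm_square cnj_sum sum_product .
  qed
  also have "(\<Sum>j<n. \<Sum>k<n. d j * cnj (d k) * (if int j - int k = 0 then 1 else 0))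
      = of_real (\<Sum>k<n. (norm (d k))\<^sup>2)"
    unfolding of_real_sum complex_norm_square
    by (intro sum.cong refl) (simp add: if_distrib cong: if_cong)
  finally show ?thesis
    by (drule_tac has_integral_linear[OF _ bounded_linear_Re]) (simp only: o_def Re_complex_of_real)
qed

text \<open>
  The finite orthogonality relation passes to the limit by dominated convergence, with
  the squared sum of the absolute coefficients as the dominating constant.
\<close>

lemma parseval:
  fixes d :: "nat \<Rightarrow> complex"
  assumes "summable (\<lambda>k. norm (d k))"
  shows "(\<lambda>t. (norm (\<Sum>k. d k * cis (2 * pi * t) ^ k))\<^sup>2) integrable_on {0..1}"
    and "(\<lambda>k. (norm (d k))\<^sup>2) sums integral {0..1} (\<lambda>t. (norm (\<Sum>k. d k * cis (2 * pi * t) ^ k))\<^sup>2)"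
proof -
  let ?P = "\<lambda>n t. (norm (\<Sum>k<n. d k * cis (2 * pi * t) ^ k))\<^sup>2"
  have norm_term: "norm (d k * cis (2 * pi * t) ^ k) = norm (d k)" for k t
    by (simp add: norm_mult norm_power)
  have bound: "norm (?P n t) \<le> (\<Sum>k. norm (d k))\<^sup>2" for n t
  proof -
    have "norm (\<Sum>k<n. d k * cis (2 * pi * t) ^ k) \<le> (\<Sum>k<n. norm (d k * cis (2 * pi * t) ^ k))"
      by (rule norm_sum)
    also have "\<dots> \<le> (\<Sum>k. norm (d k))"
      unfolding norm_term by (rule sum_le_suminf) (use assms in auto)
    finally show ?thesis
      by (simp add: power_mono)
  qed
  have lim: "(\<lambda>n. ?P n t) \<longlonglongrightarrow> (norm (\<Sum>k. d k * cis (2 * pi * t) ^ k))\<^sup>2" for t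
  proof -
    have "summable (\<lambda>k. d k * cis (2 * pi * t) ^ k)"
      by (rule summable_norm_cancel) (use assms norm_term in simp)
    then show ?thesis
      by (intro tendsto_intros summable_LIMSEQ)
  qed
  note dc = dominated_convergence[of ?P "{0..1}" "\<lambda>_. (\<Sum>k. norm (d k))\<^sup>2", OF _ _ bound lim]
  have int: "?P n integrable_on {0..1}" for n
    using parseval_finite by blast
  show "(\<lambda>t. (norm (\<Sum>k. d k * cis (2 * pi * t) ^ k))\<^sup>2) integrable_on {0..1}"
    by (rule dc(1)[OF int]) auto
  have "(\<lambda>n. integral {0..1} (?P n)) \<longlonglongrightarrow>
      integral {0..1} (\<lambda>t. (norm (\<Sum>k. d k * cis (2 * pi * t) ^ k))\<^sup>2)"
    by (rule dc(2)[OF int]) auto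
  moreover have "integral {0..1} (?P n) = (\<Sum>k<n. (norm (d k))\<^sup>2)" for n
    by (rule integral_unique[OF parseval_finite])
  ultimately show "(\<lambda>k. (norm (d k))\<^sup>2) sums
      integral {0..1} (\<lambda>t. (norm (\<Sum>k. d k * cis (2 * pi * t) ^ k))\<^sup>2)"
    by (simp add: sums_def)
qed

text \<open>
  A pointwise comparison of two power series on one circle becomes a comparison of their
  weighted square sums of coefficients; this is how the geometric Schwarz-Pick inequality is
  turned into a statement about coefficients.
\<close>

lemma weighted_square_sum_mono:
  fixes F G :: "complex \<Rightarrow> complex"
  assumes F: "\<And>z. norm z < 1 \<Longrightarrow> (\<lambda>k. b k * z ^ k) sums F z"
    and G: "\<And>z. norm z < 1 \<Longrightarrow> (\<lambda>k. c k * z ^ k) sums G z"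
    and x: "0 \<le> x" "x < 1"
    and le: "\<And>z. norm z = x \<Longrightarrow> norm (F z) \<le> q * norm (G z)"
  shows "summable (\<lambda>k. (norm (b k))\<^sup>2 * (x\<^sup>2) ^ k)"
    and "(\<Sum>k. (norm (b k))\<^sup>2 * (x\<^sup>2) ^ k) \<le> q\<^sup>2 * (\<Sum>k. (norm (c k))\<^sup>2 * (x\<^sup>2) ^ k)"
proof -
  have summ: "summable (\<lambda>k. norm (e k * of_real x ^ k))"
    if "\<forall>z. norm z < 1 \<longrightarrow> (\<lambda>k. e k * z ^ k) sums E z" for e :: "nat \<Rightarrow> complex" and E
  proof -
    obtain y where "x < y" "y < 1" using x dense by blast
    then show ?thesis
      using that[rule_format, of "of_real y"] x by (intro powser_insidea[of e "of_real y"]) (auto simp: sums_iff)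
  qed
  have val: "(\<Sum>k. e k * of_real x ^ k * cis (2 * pi * t) ^ k) = E (of_real x * cis (2 * pi * t))"
    if "\<forall>z. norm z < 1 \<longrightarrow> (\<lambda>k. e k * z ^ k) sums E z" for e :: "nat \<Rightarrow> complex" and E t
    using that[rule_format, of "of_real x * cis (2 * pi * t)"] x
    by (simp add: sums_iff norm_mult power_mult_distrib mult.assoc)
  have sq: "(norm (e k * of_real x ^ k))\<^sup>2 = (norm (e k))\<^sup>2 * (x\<^sup>2) ^ k" for e :: "nat \<Rightarrow> complex" and k
    using x by (simp add: norm_mult norm_power power_mult_distrib flip: power_mult)
      (simp add: mult.commute)
  have F': "\<forall>z. norm z < 1 \<longrightarrow> (\<lambda>k. b k * z ^ k) sums F z"
    and G': "\<forall>z. norm z < 1 \<longrightarrow> (\<lambda>k. c k * z ^ k) sums G z"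
    using F G by blast+
  note PF = parseval[OF summ[OF F'], unfolded sq val[OF F']]
  note PG = parseval[OF summ[OF G'], unfolded sq val[OF G']]
  show "summable (\<lambda>k. (norm (b k))\<^sup>2 * (x\<^sup>2) ^ k)"
    using PF(2) by (auto simp: sums_iff)
  have "integral {0..1} (\<lambda>t. (norm (F (of_real x * cis (2 * pi * t))))\<^sup>2)
      \<le> integral {0..1} (\<lambda>t. q\<^sup>2 * (norm (G (of_real x * cis (2 * pi * t))))\<^sup>2)"
  proof (rule integral_le)
    fix t :: real
    have "norm (F (of_real x * cis (2 * pi * t))) \<le> q * norm (G (of_real x * cis (2 * pi * t)))"
      using x by (intro le) (simp add: norm_mult)
    then show "(norm (F (of_real x * cis (2 * pi * t))))\<^sup>2
        \<le> q\<^sup>2 * (norm (G (of_real x * cis (2 * pi * t))))\<^sup>2"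
      by (metis norm_ge_zero power_mono power_mult_distrib)
  qed (use PF PG in \<open>auto intro: integrable_on_mult_right\<close>)
  then show "(\<Sum>k. (norm (b k))\<^sup>2 * (x\<^sup>2) ^ k) \<le> q\<^sup>2 * (\<Sum>k. (norm (c k))\<^sup>2 * (x\<^sup>2) ^ k)"
    using PF PG by (simp add: sums_iff)
qed

section \<open>The Schwarz-Pick inequality at the origin\<close>

lemma norm_less_1_if_norm_centre_less_1:
  assumes "g holomorphic_on ball 0 1" "g ` ball 0 1 \<subseteq> cball 0 1" "norm (g 0) < 1" "norm z < 1"
  shows "norm (g z) < 1"
proof (rule ccontr)
  assume "\<not> norm (g z) < 1"
  then have "norm (g w) \<le> norm (g z)" if "norm w < 1" for w
    using assms(2) that by (force simp: image_subset_iff)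
  then have "g constant_on ball 0 1"
    using assms by (intro maximum_modulus_principle[of g _ "ball 0 1" z]) auto
  then have "g z = g 0"
    using assms(4) by (auto simp: constant_on_def)
  with assms(3) \<open>\<not> norm (g z) < 1\<close> show False by simp
qed

text \<open>
  The Moebius map sending \<open>g 0\<close> to the origin brings \<open>g\<close> into the
  scope of the Schwarz lemma.
\<close>

lemma moebius_normalization:
  assumes g: "g holomorphic_on ball 0 1" "g ` ball 0 1 \<subseteq> cball 0 1" "norm (g 0) < 1"
  defines "\<omega> \<equiv> \<lambda>z. (g z - g 0) / (1 - cnj (g 0) * g z)"
  shows "\<omega> holomorphic_on ball 0 1" and "\<And>z. norm z < 1 \<Longrightarrow> norm (\<omega> z) < 1"
    and "\<And>z. norm z < 1 \<Longrightarrow> 1 - cnj (g 0) * g z \<noteq> 0"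
proof -
  have lt: "norm (g z) < 1" if "norm z < 1" for z
    using norm_less_1_if_norm_centre_less_1[OF g that] .
  show nz: "1 - cnj (g 0) * g z \<noteq> 0" if "norm z < 1" for z
  proof
    assume "1 - cnj (g 0) * g z = 0"
    then have "norm (cnj (g 0) * g z) = 1" by (metis eq_iff_diff_eq_0 norm_one)
    moreover have "norm (g 0) * norm (g z) < 1 * 1"
      using lt[OF that] g(3) by (intro mult_strict_mono') auto
    ultimately show False by (simp add: norm_mult)
  qed
  show "\<omega> holomorphic_on ball 0 1"
    unfolding \<omega>_def by (intro holomorphic_intros g) (use nz in auto)
  show "norm (\<omega> z) < 1" if "norm z < 1" for z
    using Moebius_function_norm_lt_1[of "g 0" "g z" 0] g(3) lt[OF that]
    by (simp add: \<omega>_def Moebius_function_def)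
qed

lemma schwarz_pick_at_0:
  assumes g: "g holomorphic_on ball 0 1" "g ` ball 0 1 \<subseteq> cball 0 1" "norm (g 0) < 1"
    and z: "norm z < 1"
  shows "norm (g z - g 0) \<le> norm z * norm (1 - cnj (g 0) * g z)"
proof -
  define \<omega> where "\<omega> = (\<lambda>z. (g z - g 0) / (1 - cnj (g 0) * g z))"
  note w = moebius_normalization[OF g, folded \<omega>_def]
  have "norm (\<omega> z) \<le> norm z"
    using w z by (intro Schwarz_Lemma(1)) (auto simp: \<omega>_def)
  with w(3)[OF z] show ?thesis
    by (simp add: \<omega>_def norm_divide field_simps)
qed

text \<open>
  The derivative at the origin alone decides equality: it forces the normalized function
  to be a rotation, and inverting the Moebius map recovers \<open>g\<close>. The final
  uniqueness statement needs only this one coefficient.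
\<close>

lemma schwarz_pick_equality:
  assumes g: "g holomorphic_on ball 0 1" "g ` ball 0 1 \<subseteq> cball 0 1" "norm (g 0) < 1"
    and eq: "norm (deriv g 0) = 1 - (norm (g 0))\<^sup>2"
  obtains \<alpha> where "norm \<alpha> = 1" "\<And>z. norm z < 1 \<Longrightarrow> g z = (g 0 + \<alpha> * z) / (1 + cnj (g 0) * \<alpha> * z)"
proof -
  define \<omega> where "\<omega> = (\<lambda>z. (g z - g 0) / (1 - cnj (g 0) * g z))"
  note w = moebius_normalization[OF g, folded \<omega>_def]
  have pos: "1 - (norm (g 0))\<^sup>2 > 0"
    using g(3) by (simp add: power_less_one_iff)
  have den0: "1 - cnj (g 0) * g 0 = of_real (1 - (norm (g 0))\<^sup>2)"
    unfolding of_real_diff complex_norm_square by (simp add: mult.commute)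
  have dg: "(g has_field_derivative deriv g 0) (at 0)"
    using g(1) by (intro holomorphic_derivI[of _ "ball 0 1"]) auto
  have "(\<omega> has_field_derivative deriv g 0 / (1 - cnj (g 0) * g 0)) (at 0)"
    unfolding \<omega>_def using w(3)[of 0]
    by (auto intro!: derivative_eq_intros dg simp: divide_simps)
  then have "norm (deriv \<omega> 0) = 1"
    using pos unfolding den0 by (simp only: DERIV_imp_deriv norm_divide norm_of_real eq) simp
  then obtain \<alpha> where a: "\<And>z. norm z < 1 \<Longrightarrow> \<omega> z = \<alpha> * z" "norm \<alpha> = 1"
    using Schwarz_Lemma(3)[of \<omega> 0] w by (auto simp: \<omega>_def)
  show ?thesis
  proof (rule that[OF a(2)])
    fix z :: complex assume z: "norm z < 1"
    have "norm (cnj (g 0) * \<alpha> * z) < 1"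
      using z g(3) a(2) mult_strict_mono'[of "norm (g 0)" 1 "norm z" 1] by (simp add: norm_mult)
    then have nz: "1 + cnj (g 0) * \<alpha> * z \<noteq> 0"
      by (metis add_eq_0_iff norm_minus_cancel norm_one order_less_irrefl)
    have "g z - g 0 = \<alpha> * z * (1 - cnj (g 0) * g z)"
      using a(1)[OF z] w(3)[OF z] by (simp add: \<omega>_def field_simps)
    then have "g z * (1 + cnj (g 0) * \<alpha> * z) = g 0 + \<alpha> * z"
      by (simp add: algebra_simps)
    then show "g z = (g 0 + \<alpha> * z) / (1 + cnj (g 0) * \<alpha> * z)"
      using nz by (simp add: field_simps)
  qed
qed

section \<open>Coefficients of functions bounded by one\<close>

lemma power_series_on_unit_disk:
  fixes b :: "nat \<Rightarrow> complex"
  assumes "\<And>z. norm z < 1 \<Longrightarrow> (\<lambda>k. b k * z ^ k) sums g z"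
  shows "g holomorphic_on ball 0 1" and "g 0 = b 0"
proof -
  show "g holomorphic_on ball 0 1"
    using assms by (intro power_series_holomorphic[of 0 1 b]) auto
  show "g 0 = b 0"
    using assms[of 0] by (metis norm_zero powser_sums_zero_iff zero_less_one)
qed

lemma norm_coeff_0_le_1:
  fixes b :: "nat \<Rightarrow> complex"
  assumes g: "\<And>z. norm z < 1 \<Longrightarrow> (\<lambda>k. b k * z ^ k) sums g z"
    and le: "g ` ball 0 1 \<subseteq> cball 0 1"
  shows "norm (b 0) \<le> 1"
proof -
  have "g 0 = b 0"
    by (rule power_series_on_unit_disk(2)[OF g])
  with le show ?thesis
    by (auto simp: image_subset_iff dest: bspec[of _ _ 0])
qed

text \<open>
  By Schwarz-Pick, \<open>g - b\<^sub>0\<close> is at most \<open>sqrt R\<close> times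
  \<open>1 - cnj b\<^sub>0 * g\<close> on the circle of radius \<open>sqrt R\<close>. Apart from their constant
  terms and a constant factor both functions have the coefficients of \<open>g\<close>, so with \<open>a = norm b\<^sub>0\<close> Parseval gives
  \<open>S \<le> R * ((1 - a\<^sup>2)\<^sup>2 + a\<^sup>2 * S)\<close> for the weighted square sum \<open>S\<close>, which is
  the claim solved for \<open>S\<close>. Finite sums are used so that \<open>R = 1\<close> can be reached by
  continuity. Moebius maps attain the bound in the limit \<open>n \<rightarrow> \<infinity>\<close>.
\<close>

lemma weighted_square_sum_le:
  fixes b :: "nat \<Rightarrow> complex"
  assumes g: "\<And>z. norm z < 1 \<Longrightarrow> (\<lambda>k. b k * z ^ k) sums g z"
    and le: "g ` ball 0 1 \<subseteq> cball 0 1"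
    and a: "norm (b 0) < 1"
    and R: "0 \<le> R" "R \<le> 1"
  shows "(\<Sum>k=1..n. (norm (b k))\<^sup>2 * R ^ k)
           \<le> R * (1 - (norm (b 0))\<^sup>2)\<^sup>2 / (1 - (norm (b 0))\<^sup>2 * R)"
proof -
  define a where "a = norm (b 0)"
  have a1: "0 \<le> a" "a\<^sup>2 < 1"
    using a by (auto simp: a_def power_less_one_iff)
  have lt: "(\<Sum>k=1..n. (norm (b k))\<^sup>2 * Q ^ k) \<le> Q * (1 - a\<^sup>2)\<^sup>2 / (1 - a\<^sup>2 * Q)"
    if Q: "0 \<le> Q" "Q < 1" for Q
  proof -
    define b' where "b' = (\<lambda>k. if k = 0 then 0 else b k)"
    define c where "c = (\<lambda>k. if k = 0 then 1 - cnj (b 0) * b 0 else - cnj (b 0) * b k)"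
    define S where "S = (\<Sum>k. (norm (b' k))\<^sup>2 * Q ^ k)"
    have x: "0 \<le> sqrt Q" "sqrt Q < 1"
      using Q by auto
    have single: "(\<lambda>k. (if k = 0 then e else 0) * z ^ k) sums e" for e z :: complex
      using sums_single[of 0 "\<lambda>k. e"] by (rule sums_cong[THEN iffD1, rotated]) auto
    have F: "(\<lambda>k. b' k * z ^ k) sums (g z - b 0)" if "norm z < 1" for z
    proof -
      have "(\<lambda>k. b k * z ^ k - (if k = 0 then b 0 else 0) * z ^ k) sums (g z - b 0)"
        by (intro sums_diff g that single)
      then show ?thesis
        by (rule sums_cong[THEN iffD1, rotated]) (auto simp: b'_def)
    qed
    have G: "(\<lambda>k. c k * z ^ k) sums (1 - cnj (b 0) * g z)" if "norm z < 1" for z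
    proof -
      have "(\<lambda>k. (if k = 0 then 1 else 0) * z ^ k - cnj (b 0) * (b k * z ^ k))
          sums (1 - cnj (b 0) * g z)"
        by (intro sums_diff sums_mult g that single)
      then show ?thesis
        by (rule sums_cong[THEN iffD1, rotated]) (auto simp: c_def)
    qed
    have "norm (g z - b 0) \<le> norm z * norm (1 - cnj (b 0) * g z)" if "norm z < 1" for z
      using schwarz_pick_at_0[of g z] power_series_on_unit_disk[of b g] g le a that by simp
    then have le': "norm (g z - b 0) \<le> sqrt Q * norm (1 - cnj (b 0) * g z)" if "norm z = sqrt Q" for z
      using x that by metis
    note ms = weighted_square_sum_mono[OF F G x le', unfolded real_sqrt_pow2[OF Q(1)]]
    have b': "summable (\<lambda>k. (norm (b' k))\<^sup>2 * Q ^ k)"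
      and SG: "S \<le> Q * (\<Sum>k. (norm (c k))\<^sup>2 * Q ^ k)"
      using ms by (auto simp: S_def)
    have "norm (1 - cnj (b 0) * b 0) = 1 - a\<^sup>2"
    proof -
      have "1 - cnj (b 0) * b 0 = of_real (1 - a\<^sup>2)"
        unfolding a_def of_real_diff complex_norm_square by (simp add: mult.commute)
      then show ?thesis
        using a1 by (simp only: norm_of_real)
    qed
    then have c: "(norm (c k))\<^sup>2 * Q ^ k
        = (if k = 0 then (1 - a\<^sup>2)\<^sup>2 else 0) + a\<^sup>2 * ((norm (b' k))\<^sup>2 * Q ^ k)" for k
      by (simp add: c_def b'_def a_def norm_mult power_mult_distrib)
    have "(\<lambda>k. (norm (c k))\<^sup>2 * Q ^ k) sums ((1 - a\<^sup>2)\<^sup>2 + a\<^sup>2 * S)"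
      unfolding c S_def using b' by (intro sums_add sums_mult summable_sums sums_single)
    with SG have "S \<le> Q * ((1 - a\<^sup>2)\<^sup>2 + a\<^sup>2 * S)"
      by (simp add: sums_iff)
    moreover have "1 - a\<^sup>2 * Q > 0"
      using a1 Q mult_strict_mono'[of "a\<^sup>2" 1 Q 1] by auto
    ultimately have "S \<le> Q * (1 - a\<^sup>2)\<^sup>2 / (1 - a\<^sup>2 * Q)"
      by (simp add: field_simps)
    moreover have "(\<Sum>k=1..n. (norm (b k))\<^sup>2 * Q ^ k) = (\<Sum>k=1..n. (norm (b' k))\<^sup>2 * Q ^ k)"
      by (rule sum.cong) (auto simp: b'_def)
    moreover have "\<dots> \<le> S"
      unfolding S_def using b' Q by (intro sum_le_suminf) auto
    ultimately show ?thesis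
      by linarith
  qed
  have "(\<Sum>k=1..n. (norm (b k))\<^sup>2 * R ^ k) \<le> R * (1 - a\<^sup>2)\<^sup>2 / (1 - a\<^sup>2 * R)"
  proof (cases "R < 1")
    case True
    with lt R show ?thesis by blast
  next
    case False
    then have [simp]: "R = 1" using R by simp
    have "((\<lambda>Q. \<Sum>k=1..n. (norm (b k))\<^sup>2 * Q ^ k) \<longlongrightarrow> (\<Sum>k=1..n. (norm (b k))\<^sup>2 * R ^ k)) (at_left R)"
      by (intro tendsto_intros)
    moreover have "((\<lambda>Q. Q * (1 - a\<^sup>2)\<^sup>2 / (1 - a\<^sup>2 * Q)) \<longlongrightarrow> R * (1 - a\<^sup>2)\<^sup>2 / (1 - a\<^sup>2 * R)) (at_left R)"
      by (intro tendsto_intros) (use a1 in simp)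
    moreover have "\<forall>\<^sub>F Q in at_left R. (\<Sum>k=1..n. (norm (b k))\<^sup>2 * Q ^ k) \<le> Q * (1 - a\<^sup>2)\<^sup>2 / (1 - a\<^sup>2 * Q)"
      using eventually_at_left_real[of 0 1] by (auto elim!: eventually_mono intro!: lt simp del: One_nat_def)
    ultimately show ?thesis
      by (intro tendsto_le[of "at_left R"]) auto
  qed
  then show ?thesis by (simp add: a_def)
qed

text \<open>
  The maximum principle makes \<open>g\<close> constant, and a comparison of the square sum of its
  higher coefficients with that of the zero series makes these vanish.
\<close>

lemma constant_if_norm_coeff_0_eq_1:
  fixes b :: "nat \<Rightarrow> complex"
  assumes g: "\<And>z. norm z < 1 \<Longrightarrow> (\<lambda>k. b k * z ^ k) sums g z"
    and le: "g ` ball 0 1 \<subseteq> cball 0 1"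
    and a: "norm (b 0) = 1"
    and k: "k > 0"
  shows "b k = 0"
proof -
  note hol = power_series_on_unit_disk[of b g, OF g]
  have "g constant_on ball 0 1"
    using hol le a by (intro maximum_modulus_principle[of g _ "ball 0 1" 0]) (auto simp: image_subset_iff)
  then have const: "g z = b 0" if "norm z < 1" for z
    using hol(2) that by (force simp: constant_on_def)
  have F: "(\<lambda>k. b k * z ^ k) sums g z" if "norm z < 1" for z
    using g that .
  have G: "(\<lambda>k. (if k = 0 then b 0 else 0) * z ^ k) sums b 0" for z
    using sums_single[of 0 "\<lambda>k. b 0"] by (rule sums_cong[THEN iffD1, rotated]) auto
  have D: "(\<lambda>k. (b k - (if k = 0 then b 0 else 0)) * z ^ k) sums (g z - b 0)" if "norm z < 1" for z
    using sums_diff[OF F[OF that] G[of z]] by (simp add: left_diff_distrib)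
  have Z: "(\<lambda>k. 0 * z ^ k) sums 0" for z :: complex
    by simp
  note ms = weighted_square_sum_mono[of _ "\<lambda>z. g z - b 0" "\<lambda>k. 0" "\<lambda>z. 0" "1/2" 0, OF D Z]
  let ?t = "\<lambda>k. (norm (b k - (if k = 0 then b 0 else 0)))\<^sup>2 * ((1/2)\<^sup>2) ^ k"
  have "summable ?t" "suminf ?t \<le> 0"
    using ms const by auto
  then have "?t k = 0"
    using suminf_eq_zero_iff[of ?t] suminf_nonneg[of ?t] by (auto simp del: power_eq_0_iff)
  with k show ?thesis by simp
qed

text \<open>
  The inequality of arithmetic and geometric means compares each \<open>norm (b k)\<close> with
  \<open>B k = (1 - c\<^sup>2) * c ^ (k - 1)\<close>, the absolute coefficients of the Moebius map with
  parameter \<open>c\<close>. The weights this produces are geometric with ratio \<open>\<rho> / c \<le> 1\<close>, so the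
  square sums are under control. The defect at \<open>k = 1\<close> is kept on the left-hand side because
  it identifies the extremal functions.
\<close>

lemma abs_coeff_sum_le:
  fixes b :: "nat \<Rightarrow> complex"
  assumes g: "\<And>z. norm z < 1 \<Longrightarrow> (\<lambda>k. b k * z ^ k) sums g z"
    and le: "g ` ball 0 1 \<subseteq> cball 0 1"
    and a: "norm (b 0) < 1"
    and \<rho>: "0 < \<rho>" "\<rho> \<le> c" "c < 1"
    and n: "1 \<le> n"
  shows "(\<Sum>k=1..n. norm (b k) * \<rho> ^ k) + (norm (b 1) - (1 - c\<^sup>2))\<^sup>2 * \<rho> / (2 * (1 - c\<^sup>2))
    \<le> (\<rho> * (1 - (norm (b 0))\<^sup>2)\<^sup>2 / ((1 - c\<^sup>2) * (1 - (norm (b 0))\<^sup>2 * (\<rho> / c)))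
         + \<rho> * (1 - c\<^sup>2) / (1 - c * \<rho>)) / 2"
proof -
  define a where "a = norm (b 0)"
  define R where "R = \<rho> / c"
  define w where "w = c / (1 - c\<^sup>2)"
  \<comment> \<open>The weights are chosen so that \<open>w * R ^ k * B k = \<rho> ^ k\<close>.\<close>
  define B where "B = (\<lambda>k. (1 - c\<^sup>2) * c ^ (k - 1))"
  define \<delta> where "\<delta> = (norm (b 1) - (1 - c\<^sup>2))\<^sup>2 * \<rho> / (2 * (1 - c\<^sup>2))"
  have c: "0 < c" "1 - c\<^sup>2 > 0" "w > 0"
    using \<rho> by (auto simp: power_less_one_iff w_def)
  have R: "0 < R" "R \<le> 1"
    using \<rho> c by (auto simp: R_def)
  have c\<rho>: "c * \<rho> < 1" "0 \<le> c * \<rho>"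
    using \<rho> c mult_strict_mono'[of c 1 \<rho> 1] by auto
  have wRB: "w * R ^ k * B k = \<rho> ^ k" if "k \<ge> 1" for k
  proof -
    from that obtain j where "k = Suc j" by (cases k) auto
    then show ?thesis
      using c by (simp add: w_def R_def B_def field_simps)
  qed
  have complete_square: "norm (b k) * \<rho> ^ k + w * R ^ k * (norm (b k) - B k)\<^sup>2 / 2
      = (w * ((norm (b k))\<^sup>2 * R ^ k) + B k * \<rho> ^ k) / 2" if "k \<ge> 1" for k
    unfolding wRB[OF that, symmetric] by (simp add: power2_eq_square field_simps)
  have termwise: "norm (b k) * \<rho> ^ k + (if k = 1 then \<delta> else 0)
      \<le> (w * ((norm (b k))\<^sup>2 * R ^ k) + B k * \<rho> ^ k) / 2" if "k \<ge> 1" for k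
  proof -
    have "(if k = 1 then \<delta> else 0) \<le> w * R ^ k * (norm (b k) - B k)\<^sup>2 / 2"
      using c R by (auto simp: \<delta>_def B_def w_def R_def field_simps)
    then show ?thesis
      using complete_square[OF that] by linarith
  qed
  have "(\<Sum>k=1..n. norm (b k) * \<rho> ^ k) + \<delta>
      = (\<Sum>k=1..n. norm (b k) * \<rho> ^ k + (if k = 1 then \<delta> else 0))"
    using n by (simp add: sum.distrib)
  also have "\<dots> \<le> (\<Sum>k=1..n. (w * ((norm (b k))\<^sup>2 * R ^ k) + B k * \<rho> ^ k) / 2)"
    by (intro sum_mono termwise) simp
  also have "\<dots> = (w * (\<Sum>k=1..n. (norm (b k))\<^sup>2 * R ^ k) + (\<Sum>k=1..n. B k * \<rho> ^ k)) / 2"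
    by (simp add: sum_divide_distrib[symmetric] sum.distrib sum_distrib_left)
  also have "\<dots> \<le> (w * (R * (1 - a\<^sup>2)\<^sup>2 / (1 - a\<^sup>2 * R)) + \<rho> * (1 - c\<^sup>2) / (1 - c * \<rho>)) / 2"
  proof -
    have "(\<Sum>k=1..n. (norm (b k))\<^sup>2 * R ^ k) \<le> R * (1 - a\<^sup>2)\<^sup>2 / (1 - a\<^sup>2 * R)"
      unfolding a_def by (rule weighted_square_sum_le[OF g le a]) (use R in auto)
    moreover have "(\<Sum>k=1..n. B k * \<rho> ^ k) \<le> \<rho> * (1 - c\<^sup>2) / (1 - c * \<rho>)"
    proof -
      have "(\<Sum>k=1..n. B k * \<rho> ^ k) = (\<Sum>k<n. B (Suc k) * \<rho> ^ Suc k)"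
        by (simp add: sum.atLeast1_atMost_eq)
      also have "\<dots> = \<rho> * (1 - c\<^sup>2) * (\<Sum>k<n. (c * \<rho>) ^ k)"
        by (simp add: B_def sum_distrib_left power_mult_distrib mult_ac)
      also have "\<dots> \<le> \<rho> * (1 - c\<^sup>2) * (1 / (1 - c * \<rho>))"
        using c\<rho> c \<rho> by (intro mult_left_mono) (auto simp: sum_gp_strict divide_right_mono)
      finally show ?thesis by simp
    qed
    ultimately show ?thesis
      using c by (intro divide_right_mono add_mono mult_left_mono) auto
  qed
  also have "w * (R * (1 - a\<^sup>2)\<^sup>2 / (1 - a\<^sup>2 * R)) = \<rho> * (1 - a\<^sup>2)\<^sup>2 / ((1 - c\<^sup>2) * (1 - a\<^sup>2 * R))"
    using c by (simp add: w_def R_def)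
  finally show ?thesis
    by (simp add: \<delta>_def a_def R_def)
qed

section \<open>The sharp coefficient sum\<close>

text \<open>
  The function \<open>(w - a) / (1 - a * w)\<close> has majorant
  \<open>a + \<rho> * (1 - a\<^sup>2) / (1 - a * \<rho>)\<close> at \<open>\<rho>\<close>. The relation between \<open>\<rho>\<close>
  and \<open>s\<close> is the equation of the radius written for \<open>\<rho> = r ^ p\<close> and \<open>s = r ^ (p - m)\<close>.
  It is exactly the relation under which the numerator of the gap to \<open>s / \<rho>\<close> is a perfect square in \<open>a\<close>;
  its zero is the extremal parameter.
\<close>

lemma moebius_majorant_gap:
  fixes a \<rho> s :: real
  assumes \<rho>: "0 < \<rho>" and a\<rho>: "a * \<rho> < 1" and s: "8 * \<rho>\<^sup>2 = 6 * s - s\<^sup>2 - 1"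
  shows "a + \<rho> * (1 - a\<^sup>2) / (1 - a * \<rho>) + 2 * (a * \<rho> - (1 + s) / 4)\<^sup>2 / (\<rho> * (1 - a * \<rho>)) = s / \<rho>"
proof -
  define u where "u = 1 - a * \<rho>"
  define e where "e = \<rho> * (1 - a\<^sup>2)"
  define q where "q = 2 * (a * \<rho> - (1 + s) / 4)\<^sup>2"
  have u: "u > 0" using a\<rho> by (simp add: u_def)
  have "a * \<rho> * u + \<rho> * e + q = s * u"
    using s by (simp add: u_def e_def q_def field_simps power2_eq_square)
  then have "a + e / u + q / (\<rho> * u) = s / \<rho>"
    using u \<rho> by (simp add: field_simps)
  then show ?thesis
    by (simp add: u_def e_def q_def)
qed

text \<open>
  Here \<open>c = norm (b 0)\<close> is allowed in the previous estimate and is the best choice: the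
  two halves of the bound agree and give the majorant of a Moebius map. The two extra terms on
  the left both vanish only for the extremal parameter and a maximal first coefficient.
\<close>

lemma coeff_sum_le_of_large_coeff_0:
  fixes b :: "nat \<Rightarrow> complex"
  assumes g: "\<And>z. norm z < 1 \<Longrightarrow> (\<lambda>k. b k * z ^ k) sums g z"
    and le: "g ` ball 0 1 \<subseteq> cball 0 1"
    and a: "\<rho> \<le> norm (b 0)" "norm (b 0) < 1"
    and \<rho>: "0 < \<rho>" and s: "8 * \<rho>\<^sup>2 = 6 * s - s\<^sup>2 - 1"
    and n: "1 \<le> n"
  shows "(\<Sum>k\<le>n. norm (b k) * \<rho> ^ k)
      + (norm (b 1) - (1 - (norm (b 0))\<^sup>2))\<^sup>2 * \<rho> / (2 * (1 - (norm (b 0))\<^sup>2))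
      + 2 * (norm (b 0) * \<rho> - (1 + s) / 4)\<^sup>2 / (\<rho> * (1 - norm (b 0) * \<rho>)) \<le> s / \<rho>"
proof -
  define a where "a = norm (b 0)"
  have a1: "0 < a" "a < 1" "\<rho> \<le> a" "1 - a\<^sup>2 > 0"
    using \<rho> assms by (auto simp: a_def power_less_one_iff)
  have a\<rho>: "1 - a * \<rho> > 0"
    using a1 \<rho> mult_strict_mono'[of a 1 \<rho> 1] by auto
  define h where "h = \<rho> * (1 - a\<^sup>2) / (1 - a * \<rho>)"
  have e1: "\<rho> * (1 - a\<^sup>2)\<^sup>2 / ((1 - a\<^sup>2) * (1 - a\<^sup>2 * (\<rho> / a))) = h"
  proof -
    have "1 - a\<^sup>2 * (\<rho> / a) = 1 - a * \<rho>"
      using a1 by (simp add: power2_eq_square)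
    then show ?thesis
      using a1 by (simp add: h_def power2_eq_square[of "1 - a\<^sup>2"])
  qed
  have "(\<Sum>k=1..n. norm (b k) * \<rho> ^ k) + (norm (b 1) - (1 - a\<^sup>2))\<^sup>2 * \<rho> / (2 * (1 - a\<^sup>2)) \<le> h"
    using abs_coeff_sum_le[OF g le a(2) \<rho> a(1) a(2) n, folded a_def, unfolded e1]
    unfolding h_def[symmetric] by simp
  moreover have "(\<Sum>k\<le>n. norm (b k) * \<rho> ^ k) = a + (\<Sum>k=1..n. norm (b k) * \<rho> ^ k)"
    using sum.atMost_shift[of "\<lambda>k. norm (b k) * \<rho> ^ k" n]
    by (simp add: a_def sum.atLeast1_atMost_eq)
  moreover have "a + h + 2 * (a * \<rho> - (1 + s) / 4)\<^sup>2 / (\<rho> * (1 - a * \<rho>)) = s / \<rho>"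
    unfolding h_def using \<rho> a\<rho> s by (intro moebius_majorant_gap) auto
  ultimately show ?thesis
    unfolding a_def[symmetric] by linarith
qed

text \<open>
  When \<open>norm (b 0) < \<rho>\<close>, the ratio \<open>\<rho> / c\<close> is at most one only for \<open>c \<ge> \<rho>\<close>, and
  \<open>c = \<rho>\<close> is taken. The resulting bound increases with \<open>norm (b 0)\<close> because
  \<open>\<rho>\<^sup>2 \<le> 1 / 2\<close>, and it equals \<open>2 * \<rho>\<close> at \<open>norm (b 0) = \<rho>\<close>; so
  functions of this kind stay strictly below that value.
\<close>

lemma coeff_sum_le_of_small_coeff_0:
  fixes b :: "nat \<Rightarrow> complex"
  assumes g: "\<And>z. norm z < 1 \<Longrightarrow> (\<lambda>k. b k * z ^ k) sums g z"
    and le: "g ` ball 0 1 \<subseteq> cball 0 1"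
    and a: "norm (b 0) < \<rho>"
    and \<rho>: "\<rho>\<^sup>2 \<le> 1 / 2"
    and n: "1 \<le> n"
  shows "(\<Sum>k\<le>n. norm (b k) * \<rho> ^ k)
    \<le> 2 * \<rho> - (\<rho> - norm (b 0)) * (1 - \<rho> * (\<rho> + norm (b 0)) / (2 * (1 - \<rho>\<^sup>2)))"
    and "(\<rho> - norm (b 0)) * (1 - \<rho> * (\<rho> + norm (b 0)) / (2 * (1 - \<rho>\<^sup>2))) > 0"
proof -
  define a where "a = norm (b 0)"
  have "\<rho> < 1"
    using power_less_imp_less_base[of \<rho> 2 1] \<rho> by simp
  moreover have "0 \<le> a" "a < \<rho>"
    using a by (auto simp: a_def)
  ultimately have *: "0 < \<rho>" "\<rho> < 1" "0 \<le> a" "a < \<rho>" "a < 1" "1 - \<rho>\<^sup>2 > 0" "1 - a\<^sup>2 > 0"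
    by (auto simp: power_less_one_iff)
  have "(\<Sum>k=1..n. norm (b k) * \<rho> ^ k) + (norm (b 1) - (1 - \<rho>\<^sup>2))\<^sup>2 * \<rho> / (2 * (1 - \<rho>\<^sup>2))
      \<le> (\<rho> * (1 - a\<^sup>2)\<^sup>2 / ((1 - \<rho>\<^sup>2) * (1 - a\<^sup>2 * (\<rho> / \<rho>))) + \<rho> * (1 - \<rho>\<^sup>2) / (1 - \<rho> * \<rho>)) / 2"
    using abs_coeff_sum_le[OF g le _ _ order_refl _ n, of \<rho>] * by (simp add: a_def)
  also have "\<dots> = (\<rho> * (1 - a\<^sup>2) / (1 - \<rho>\<^sup>2) + \<rho>) / 2"
    using * by (simp add: power2_eq_square)
  finally have "(\<Sum>k=1..n. norm (b k) * \<rho> ^ k) \<le> (\<rho> * (1 - a\<^sup>2) / (1 - \<rho>\<^sup>2) + \<rho>) / 2"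
    using * by (smt (verit) divide_nonneg_pos mult_nonneg_nonneg zero_le_power2)
  moreover have "a + (\<rho> * (1 - a\<^sup>2) / (1 - \<rho>\<^sup>2) + \<rho>) / 2
      = 2 * \<rho> - (\<rho> - a) * (1 - \<rho> * (\<rho> + a) / (2 * (1 - \<rho>\<^sup>2)))"
    using * by (simp add: divide_simps) (simp add: algebra_simps power2_eq_square)
  moreover have "(\<Sum>k\<le>n. norm (b k) * \<rho> ^ k) = a + (\<Sum>k=1..n. norm (b k) * \<rho> ^ k)"
    using sum.atMost_shift[of "\<lambda>k. norm (b k) * \<rho> ^ k" n]
    by (simp add: a_def sum.atLeast1_atMost_eq)
  ultimately show "(\<Sum>k\<le>n. norm (b k) * \<rho> ^ k)
    \<le> 2 * \<rho> - (\<rho> - norm (b 0)) * (1 - \<rho> * (\<rho> + norm (b 0)) / (2 * (1 - \<rho>\<^sup>2)))"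
    unfolding a_def[symmetric] by linarith
  have "\<rho> * (\<rho> + a) < 2 * \<rho>\<^sup>2"
    using * by (simp add: power2_eq_square)
  also have "2 * \<rho>\<^sup>2 \<le> 2 * (1 - \<rho>\<^sup>2)"
    using \<rho> by simp
  finally show "(\<rho> - norm (b 0)) * (1 - \<rho> * (\<rho> + norm (b 0)) / (2 * (1 - \<rho>\<^sup>2))) > 0"
    using * unfolding a_def by (intro mult_pos_pos) auto
qed

text \<open>
  The right-hand side \<open>s / \<rho>\<close> is what becomes \<open>r powi (-m)\<close> at the root \<open>r\<close> of the
  equation. A unimodular \<open>b 0\<close> is excluded from the equality statement because
  a constant has coefficient sum one, which is \<open>s / \<rho>\<close> when \<open>\<rho> = s\<close>.
\<close>

lemma coeff_sum_le_bohr: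
  fixes b :: "nat \<Rightarrow> complex"
  assumes g: "\<And>z. norm z < 1 \<Longrightarrow> (\<lambda>k. b k * z ^ k) sums g z"
    and le: "g ` ball 0 1 \<subseteq> cball 0 1"
    and \<rho>: "0 < \<rho>" "\<rho> \<le> s" "s \<le> 1" and s: "8 * \<rho>\<^sup>2 = 6 * s - s\<^sup>2 - 1"
  shows "summable (\<lambda>k. norm (b k) * \<rho> ^ k)"
    and "(\<Sum>k. norm (b k) * \<rho> ^ k) \<le> s / \<rho>"
    and "\<lbrakk>(\<Sum>k. norm (b k) * \<rho> ^ k) = s / \<rho>; norm (b 0) < 1\<rbrakk>
      \<Longrightarrow> norm (b 0) * \<rho> = (1 + s) / 4 \<and> norm (b 1) = 1 - (norm (b 0))\<^sup>2"
proof -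
  let ?T = "\<Sum>k. norm (b k) * \<rho> ^ k"
  \<comment> \<open>By the equation, this product equals \<open>4 - 8 * \<rho>\<^sup>2\<close>.\<close>
  have "0 \<le> (1 - s) * (5 - s)"
    using \<rho> by simp
  then have \<rho>2: "\<rho>\<^sup>2 \<le> 1 / 2"
    using s by (simp add: algebra_simps power2_eq_square)
  have \<rho>1: "\<rho> < 1"
    using power_less_imp_less_base[of \<rho> 2 1] \<rho>2 by simp
  then obtain y where y: "\<rho> < y" "y < 1" using dense by blast
  have "summable (\<lambda>k. norm (b k * of_real \<rho> ^ k))"
    using y \<rho> g[of "of_real y"] by (intro powser_insidea[of b "of_real y"]) (auto simp: sums_iff)
  then show summ: "summable (\<lambda>k. norm (b k) * \<rho> ^ k)"
    using \<rho> by (simp add: norm_mult norm_power)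
  have T_le: "?T + d \<le> C" if "\<And>n. 1 \<le> n \<Longrightarrow> (\<Sum>k\<le>n. norm (b k) * \<rho> ^ k) + d \<le> C" for C d
  proof -
    have "(\<lambda>n. \<Sum>k\<le>n. norm (b k) * \<rho> ^ k) \<longlonglongrightarrow> ?T"
      using summ by (rule summable_LIMSEQ')
    then have "?T \<le> C - d"
      by (rule LIMSEQ_le_const2) (use that in \<open>force simp: le_diff_eq\<close>)
    then show ?thesis by simp
  qed
  \<comment> \<open>By the equation, \<open>s - 2 * \<rho>\<^sup>2 = (1 - s)\<^sup>2 / 4\<close>.\<close>
  have 2: "2 * \<rho> \<le> s / \<rho>"
  proof -
    have "0 \<le> (1 - s) * (1 - s)" by simp
    then have "2 * \<rho>\<^sup>2 \<le> s"
      using s by (simp add: algebra_simps power2_eq_square)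
    then show ?thesis
      using \<rho> by (simp add: field_simps power2_eq_square)
  qed
  consider "norm (b 0) < \<rho>" | "\<rho> \<le> norm (b 0)" "norm (b 0) < 1" | "norm (b 0) = 1"
    using norm_coeff_0_le_1[of b g] g le by force
  then have "?T \<le> s / \<rho> \<and> (?T = s / \<rho> \<longrightarrow> norm (b 0) < 1 \<longrightarrow>
      norm (b 0) * \<rho> = (1 + s) / 4 \<and> norm (b 1) = 1 - (norm (b 0))\<^sup>2)"
  proof cases
    case 1
    let ?d = "(\<rho> - norm (b 0)) * (1 - \<rho> * (\<rho> + norm (b 0)) / (2 * (1 - \<rho>\<^sup>2)))"
    have "?T + ?d \<le> 2 * \<rho>"
      by (rule T_le) (use coeff_sum_le_of_small_coeff_0(1)[OF g le 1 \<rho>2] in \<open>simp add: algebra_simps\<close>)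
    moreover have "?d > 0"
      using coeff_sum_le_of_small_coeff_0(2)[OF g le 1 \<rho>2, of 1] by simp
    ultimately show ?thesis
      using 2 by linarith
  next
    case 2
    let ?d1 = "(norm (b 1) - (1 - (norm (b 0))\<^sup>2))\<^sup>2 * \<rho> / (2 * (1 - (norm (b 0))\<^sup>2))"
    let ?d2 = "2 * (norm (b 0) * \<rho> - (1 + s) / 4)\<^sup>2 / (\<rho> * (1 - norm (b 0) * \<rho>))"
    have pos: "1 - (norm (b 0))\<^sup>2 > 0" "1 - norm (b 0) * \<rho> > 0"
      using 2 \<rho> \<rho>1 mult_strict_mono'[of "norm (b 0)" 1 \<rho> 1] by (auto simp: power_less_one_iff)
    have "?T + (?d1 + ?d2) \<le> s / \<rho>"
      by (rule T_le) (use coeff_sum_le_of_large_coeff_0[OF g le 2 \<rho>(1) s] in \<open>simp only: add.assoc\<close>)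
    moreover have "?d1 \<ge> 0" "?d2 \<ge> 0"
      using pos \<rho> by auto
    ultimately have "?T \<le> s / \<rho>" and "?T = s / \<rho> \<Longrightarrow> ?d1 = 0 \<and> ?d2 = 0"
      by linarith+
    moreover have "?d1 = 0 \<Longrightarrow> norm (b 1) = 1 - (norm (b 0))\<^sup>2" "?d2 = 0 \<Longrightarrow> norm (b 0) * \<rho> = (1 + s) / 4"
      using pos \<rho> by auto
    ultimately show ?thesis
      by blast
  next
    case 3
    have "norm (b k) * \<rho> ^ k = (if k = 0 then 1 else 0)" for k
      using constant_if_norm_coeff_0_eq_1[OF g le 3, of k] 3 by auto
    then have "?T = 1"
      using sums_single[of 0 "\<lambda>_. 1 :: real"] by (simp add: sums_iff)
    then show ?thesis
      using 3 \<rho> by simp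
  qed
  then show "?T \<le> s / \<rho>"
    and "\<lbrakk>?T = s / \<rho>; norm (b 0) < 1\<rbrakk>
      \<Longrightarrow> norm (b 0) * \<rho> = (1 + s) / 4 \<and> norm (b 1) = 1 - (norm (b 0))\<^sup>2"
    by blast+
qed

section \<open>The equation for the radius\<close>

text \<open>
  For \<open>x \<ge> 1\<close> the power \<open>s = x ^ (p - m)\<close> is at most \<open>x ^ p\<close>, so the left-hand side is at least
  \<open>(3 * s - 1)\<^sup>2 > 0\<close>.
\<close>

lemma bohr_root_eq_imp_less_1:
  assumes "m \<le> p" "bohr_root_eq p m x"
  shows "x < 1"
proof (rule ccontr)
  assume "\<not> x < 1"
  then have x: "1 \<le> x" by simp
  define s where "s = x ^ (p - m)"
  have s: "1 \<le> s" "s \<le> x ^ p"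
    using x by (auto simp: s_def intro: power_increasing)
  then have "s\<^sup>2 \<le> (x ^ p)\<^sup>2"
    by (intro power_mono) auto
  moreover have "- 6 * s + s\<^sup>2 + 8 * (x ^ p)\<^sup>2 + 1 = 0"
    using assms(2) by (simp add: bohr_root_eq_def s_def mult.commute[of 2] power_mult)
  ultimately have "(3 * s - 1)\<^sup>2 \<le> 0"
    by (simp add: power2_eq_square algebra_simps)
  with s show False by simp
qed

text \<open>
  The lower end \<open>root p (1/3)\<close> is the classical Bohr radius in the variable \<open>z ^ p\<close>. The
  bound it gives for the largest root is what later puts the extremal parameter below one for \<open>m \<ge> 1\<close>.
\<close>

lemma bohr_root_eq_has_root:
  assumes "1 \<le> p" "m \<le> p"
  obtains x where "bohr_root_eq p m x" "root p (1/3) \<le> x" "x \<le> 1"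
proof -
  define F where "F x = - 6 * x ^ (p - m) + x ^ (2 * (p - m)) + 8 * x ^ (2 * p) + 1" for x :: real
  let ?y = "root p (1/3)"
  have y: "0 < ?y" "?y \<le> 1" "?y ^ p = 1/3"
    using assms by (auto simp: real_root_pow_pos2)
  have "F ?y \<le> 0"
  proof -
    define s where "s = ?y ^ (p - m)"
    have "?y ^ p \<le> s" "s \<le> 1"
      using y unfolding s_def by (auto intro: power_decreasing power_le_one)
    then have "0 \<le> (s - 1/3) * (17/3 - s)"
      using y(3) by (intro mult_nonneg_nonneg) auto
    moreover have "F ?y = - 6 * s + s\<^sup>2 + 8 * (?y ^ p)\<^sup>2 + 1"
      by (simp add: F_def s_def mult.commute[of 2] power_mult)
    ultimately show ?thesis
      unfolding y(3) by (simp add: field_simps power2_eq_square)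
  qed
  moreover have "0 \<le> F 1"
    by (simp add: F_def)
  moreover have "continuous_on {?y..1} F"
    unfolding F_def by (intro continuous_intros)
  ultimately obtain x where "?y \<le> x" "x \<le> 1" "F x = 0"
    using IVT'[of F ?y 0 1] y by auto
  then show ?thesis
    by (intro that) (auto simp: bohr_root_eq_def F_def)
qed

text \<open>
  All roots above the one just found lie in a compact set, so there is a largest one.
\<close>

lemma bohr_root_greatest:
  assumes "1 \<le> p" "m \<le> p"
  shows "bohr_root_eq p m (bohr_root p m)" and "root p (1/3) \<le> bohr_root p m"
    and "\<And>x. 0 < x \<Longrightarrow> bohr_root_eq p m x \<Longrightarrow> x \<le> bohr_root p m"
proof -
  let ?y = "root p (1/3)" and ?F = "\<lambda>x :: real. - 6 * x ^ (p - m) + x ^ (2 * (p - m)) + 8 * x ^ (2 * p) + 1"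
  define S where "S = {x \<in> {?y..1}. ?F x = 0}"
  have S: "x \<in> S \<longleftrightarrow> bohr_root_eq p m x \<and> ?y \<le> x" if "0 < x" for x
    using bohr_root_eq_imp_less_1[OF assms(2), of x] by (auto simp: S_def bohr_root_eq_def)
  have y: "0 < ?y"
    using assms by simp
  have "closed S"
    unfolding S_def by (intro continuous_closed_preimage_constant continuous_intros closed_atLeastAtMost)
  then have "compact S"
    unfolding compact_eq_bounded_closed
    by (intro conjI bounded_subset[OF bounded_closed_interval, of S ?y 1]) (auto simp: S_def)
  moreover have "S \<noteq> {}"
  proof -
    obtain x where "bohr_root_eq p m x" "?y \<le> x"
      using bohr_root_eq_has_root[OF assms] by blast
    with S[of x] y show ?thesis by auto
  qed
  ultimately obtain z where z: "z \<in> S" "\<And>x. x \<in> S \<Longrightarrow> x \<le> z"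
    using compact_attains_sup[of S] by blast
  have zy: "?y \<le> z" "0 < z"
    using z(1) y by (auto simp: S_def)
  have max: "x \<le> z" if "0 < x" "bohr_root_eq p m x" for x
    using z(2)[of x] S[of x] that zy by (cases "?y \<le> x") simp_all
  have zroot: "bohr_root_eq p m z"
    using S z zy by blast
  have "bohr_root p m = z"
    unfolding bohr_root_def by (rule Greatest_equality) (use zroot zy max in blast)+
  then show "bohr_root_eq p m (bohr_root p m)" "?y \<le> bohr_root p m"
      "\<And>x. 0 < x \<Longrightarrow> bohr_root_eq p m x \<Longrightarrow> x \<le> bohr_root p m"
    using zroot zy max by blast+
qed

text \<open>
  With \<open>\<rho> = r ^ p\<close> and \<open>s = r ^ (p - m)\<close> the equation is \<open>8 * \<rho>\<^sup>2 = 6 * s - s\<^sup>2 - 1\<close>.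
  It turns \<open>1 - \<rho>\<^sup>2\<close> into \<open>(3 - s)\<^sup>2 / 8\<close>, which removes the square roots from the extremal
  parameter.
\<close>

lemma bohr_root_properties:
  assumes "1 \<le> p" "m \<le> p"
  defines "r \<equiv> bohr_root p m"
  shows "0 < r" "r < 1" "1 / 3 \<le> r ^ p" "r ^ p \<le> r ^ (p - m)" "r ^ (p - m) \<le> 1"
    and "8 * (r ^ p)\<^sup>2 = 6 * r ^ (p - m) - (r ^ (p - m))\<^sup>2 - 1"
    and "r ^ m * (r ^ (p - m) / r ^ p) = 1"
    and "1 \<le> m \<Longrightarrow> r ^ p < r ^ (p - m)"
    and "extremal_param p m * r ^ p = (1 + r ^ (p - m)) / 4"
proof -
  note root = bohr_root_greatest[OF assms(1,2), folded r_def]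
  have y: "0 < root p (1/3)" "root p (1/3) ^ p = 1 / 3"
    using assms by (auto simp: real_root_pow_pos2)
  show r: "0 < r" "r < 1"
    using root(2) y bohr_root_eq_imp_less_1[OF assms(2) root(1)] by auto
  have "root p (1/3) ^ p \<le> r ^ p"
    using y root(2) by (intro power_mono) auto
  then show "1 / 3 \<le> r ^ p"
    using y by simp
  show "r ^ p \<le> r ^ (p - m)" and s1: "r ^ (p - m) \<le> 1"
    using r by (auto intro: power_decreasing power_le_one)
  show eq: "8 * (r ^ p)\<^sup>2 = 6 * r ^ (p - m) - (r ^ (p - m))\<^sup>2 - 1"
    using root(1) by (simp add: bohr_root_eq_def mult.commute[of 2] power_mult)
  have "r ^ m * r ^ (p - m) = r ^ p"
    using assms by (simp flip: power_add)
  then show "r ^ m * (r ^ (p - m) / r ^ p) = 1"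
    using r by simp
  show "r ^ p < r ^ (p - m)" if "1 \<le> m"
    using r assms that by (intro power_strict_decreasing) auto
  have "1 - (r ^ p)\<^sup>2 = 2 * ((3 - r ^ (p - m)) / 4)\<^sup>2"
    using eq by (simp add: power2_eq_square field_simps)
  then have "sqrt (1 - r ^ (2 * p)) = sqrt 2 * ((3 - r ^ (p - m)) / 4)"
    using s1 by (simp add: mult.commute[of 2] power_mult real_sqrt_mult)
  then show "extremal_param p m * r ^ p = (1 + r ^ (p - m)) / 4"
    using r by (simp add: extremal_param_def r_def[symmetric])
qed

section \<open>The Bohr radius as an attained supremum\<close>

lemma bohr_radius_greatest:
  shows "0 \<le> bohr_radius f" "bohr_radius f \<le> 1"
    and "\<And>\<rho>. 0 \<le> \<rho> \<Longrightarrow> \<rho> < bohr_radius f \<Longrightarrow> majorant f \<rho> \<le> 1"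
    and "\<And>r. 0 \<le> r \<Longrightarrow> r \<le> 1 \<Longrightarrow> (\<And>\<rho>. 0 \<le> \<rho> \<Longrightarrow> \<rho> < r \<Longrightarrow> majorant f \<rho> \<le> 1) \<Longrightarrow> r \<le> bohr_radius f"
proof -
  define P where "P r \<longleftrightarrow> 0 \<le> r \<and> r \<le> 1 \<and> (\<forall>\<rho>. 0 \<le> \<rho> \<and> \<rho> < r \<longrightarrow> majorant f \<rho> \<le> 1)" for r
  define R where "R = Sup (Collect P)"
  have 0: "P 0" by (simp add: P_def)
  have bdd: "bdd_above (Collect P)"
    by (rule bdd_aboveI[of _ 1]) (simp add: P_def)
  have upper: "r \<le> R" if "P r" for r
    unfolding R_def using that bdd by (intro cSup_upper) auto
  have "majorant f \<rho> \<le> 1" if \<rho>: "0 \<le> \<rho>" "\<rho> < R" for \<rho>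
  proof -
    have "\<exists>r\<in>Collect P. \<rho> < r"
      using \<rho>(2) 0 bdd unfolding R_def by (subst less_cSup_iff[symmetric]) auto
    with \<rho> show ?thesis by (auto simp: P_def)
  qed
  moreover have "R \<le> 1"
    unfolding R_def using 0 by (intro cSup_least) (blast, simp add: P_def)
  ultimately have mem: "P R"
    using upper[OF 0] by (simp add: P_def)
  have "bohr_radius f = Greatest P"
    unfolding bohr_radius_def P_def ..
  also have "\<dots> = R"
    using mem upper by (rule Greatest_equality)
  finally have rad: "bohr_radius f = R" .
  show "0 \<le> bohr_radius f" "bohr_radius f \<le> 1"
    using mem by (simp_all add: rad P_def)
  show "majorant f \<rho> \<le> 1" if "0 \<le> \<rho>" "\<rho> < bohr_radius f" for \<rho>
    using mem that by (simp add: rad P_def)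
  show "r \<le> bohr_radius f" if "0 \<le> r" "r \<le> 1" "\<And>\<rho>. 0 \<le> \<rho> \<Longrightarrow> \<rho> < r \<Longrightarrow> majorant f \<rho> \<le> 1" for r
    unfolding rad by (rule upper) (use that in \<open>simp add: P_def\<close>)
qed

lemma summable_majorant:
  assumes "f holomorphic_on ball 0 1" "0 \<le> r" "r < 1"
  shows "summable (\<lambda>k. norm (fps_nth (fps_expansion f 0) k) * r ^ k)"
proof -
  have "ereal 1 \<le> fps_conv_radius (fps_expansion f 0)"
    using assms(1) by (intro conv_radius_fps_expansion) simp
  moreover have "ereal (norm (of_real r :: complex)) < ereal 1"
    using assms by simp
  ultimately have "ereal (norm (of_real r :: complex)) < conv_radius (fps_nth (fps_expansion f 0))"
    unfolding fps_conv_radius_def by order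
  then have "summable (\<lambda>k. norm (fps_nth (fps_expansion f 0) k * of_real r ^ k))"
    by (rule abs_summable_in_conv_radius)
  then show ?thesis
    using assms by (simp add: norm_mult norm_power)
qed

text \<open>
  A majorant that is still below one at \<open>r < 1\<close> stays below one a little further, by
  continuity of power series; the contrapositive is what forces equality at the Bohr radius of
  an extremal function.
\<close>

lemma bohr_radius_gt:
  assumes f: "f holomorphic_on ball 0 1" and r: "0 \<le> r" "r < 1"
    and le: "\<And>\<rho>. 0 \<le> \<rho> \<Longrightarrow> \<rho> \<le> r \<Longrightarrow> majorant f \<rho> \<le> 1" and lt: "majorant f r < 1"
  shows "r < bohr_radius f"
proof -
  obtain K where K: "r < K" "K < 1"
    using r dense by blast
  have "isCont (\<lambda>x. \<Sum>k. norm (fps_nth (fps_expansion f 0) k) * x ^ k) r"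
    by (rule isCont_powser[of _ K]) (use summable_majorant[OF f, of K] K r in auto)
  then have "isCont (majorant f) r"
    by (simp add: majorant_def[abs_def])
  then have "\<forall>\<^sub>F x in at r. majorant f x < 1"
    using lt by (intro order_tendstoD(2)) (auto simp: isCont_def)
  then obtain d where d: "d > 0" "\<And>x. x \<noteq> r \<Longrightarrow> dist x r < d \<Longrightarrow> majorant f x < 1"
    by (auto simp: eventually_at)
  have "min K (r + d) \<le> bohr_radius f"
  proof (rule bohr_radius_greatest(4))
    fix \<rho> assume "0 \<le> \<rho>" "\<rho> < min K (r + d)"
    then show "majorant f \<rho> \<le> 1"
      using le[of \<rho>] d(2)[of \<rho>] by (cases "\<rho> \<le> r") (auto simp: dist_real_def)
  qed (use K r d in auto)
  with K d show ?thesis by auto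
qed

section \<open>Lacunary series\<close>

lemma obtain_complex_root:
  fixes z :: complex
  assumes "0 < n"
  obtains w where "w ^ n = z" "norm w ^ n = norm z"
proof -
  obtain w where "w ^ n = z"
  proof (cases "z = 0")
    case True
    with assms show ?thesis by (intro that[of 0]) simp
  next
    case False
    have "exp (Ln z / of_nat n) ^ n = z"
      using assms False by (simp flip: exp_of_nat_mult)
    then show ?thesis by (rule that)
  qed
  then show ?thesis
    by (intro that[of w]) (auto simp flip: norm_power)
qed

lemma fps_expansion_of_sums:
  fixes c :: "nat \<Rightarrow> complex"
  assumes "\<And>z. norm z < 1 \<Longrightarrow> (\<lambda>n. c n * z ^ n) sums f z"
  shows "f has_fps_expansion Abs_fps c" and "fps_expansion f 0 = Abs_fps c"
proof -
  have "\<forall>\<^sub>F z :: complex in nhds 0. norm z < 1"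
    using eventually_nhds_in_open[of "ball 0 1" "0 :: complex"] by simp
  then show "f has_fps_expansion Abs_fps c"
    by (intro has_fps_expansionI) (auto elim!: eventually_mono intro: assms)
  then show "fps_expansion f 0 = Abs_fps c"
    by (rule fps_expansion_eqI)
qed

text \<open>
  The Taylor coefficients of \<open>f\<close> are found by uniqueness of power series; the missing
  exponents contribute nothing to the majorant.
\<close>

lemma majorant_sums_lacunary:
  fixes b :: "nat \<Rightarrow> complex"
  assumes p: "1 \<le> p" and f: "\<And>z. norm z < 1 \<Longrightarrow> (\<lambda>k. b k * z ^ (p * k + m)) sums f z"
  shows "(\<lambda>n. norm (fps_nth (fps_expansion f 0) n) * r ^ n) sums M \<longleftrightarrow>
         (\<lambda>k. norm (b k) * r ^ (p * k + m)) sums M"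
proof -
  define idx where "idx = (\<lambda>k. p * k + m)"
  \<comment> \<open>The full coefficient sequence of \<open>f\<close>, zero in the gaps.\<close>
  define c where "c n = (if n \<in> range idx then b (inv idx n) else 0)" for n
  have mono: "strict_mono idx"
    using p by (auto simp: idx_def strict_mono_def)
  then have c_idx: "c (idx k) = b k" for k
    by (simp add: c_def strict_mono_imp_inj_on)
  have "(\<lambda>n. c n * z ^ n) sums f z" if "norm z < 1" for z
    using f[OF that] sums_mono_reindex[OF mono, of "\<lambda>n. c n * z ^ n" "f z"]
    by (simp add: c_idx) (simp add: c_def idx_def)
  then have "fps_expansion f 0 = Abs_fps c"
    by (rule fps_expansion_of_sums)
  then show ?thesis
    using sums_mono_reindex[OF mono, of "\<lambda>n. norm (c n) * r ^ n" M]
    by (simp add: c_idx) (simp add: c_def idx_def)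
qed

text \<open>
  Convergence of the series of \<open>g\<close> at \<open>z\<close> is read off from that of \<open>f\<close> at a \<open>p\<close>-th root
  \<open>w\<close> of \<open>z\<close>. There \<open>norm (g z) \<le> 1 / norm w ^ m \<le> 1 / norm z\<close>, where the second step is
  \<open>m \<le> p\<close>. The maximum principle carries this bound from the circle of radius \<open>t\<close> to its
  inside, and \<open>t \<rightarrow> 1\<close> gives \<open>norm (g z) \<le> 1\<close>.
\<close>

lemma lacunary_factor:
  fixes b :: "nat \<Rightarrow> complex"
  assumes p: "1 \<le> p" "m \<le> p"
    and f: "\<And>z. norm z < 1 \<Longrightarrow> (\<lambda>k. b k * z ^ (p * k + m)) sums f z"
    and le: "f ` ball 0 1 \<subseteq> cball 0 1"
  defines "g \<equiv> \<lambda>z. \<Sum>k. b k * z ^ k"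
  shows "\<And>z. norm z < 1 \<Longrightarrow> (\<lambda>k. b k * z ^ k) sums g z"
    and "\<And>z. norm z < 1 \<Longrightarrow> f z = z ^ m * g (z ^ p)"
    and "g ` ball 0 1 \<subseteq> cball 0 1"
proof -
  have root: "\<exists>w. w ^ p = z \<and> norm w < 1 \<and> norm w ^ p = norm z" if z: "norm z < 1" for z :: complex
  proof -
    obtain w where w: "w ^ p = z" "norm w ^ p = norm z"
      using obtain_complex_root[of p z] p by auto
    then have "norm w < 1"
      using z p by (metis linorder_not_less one_le_power)
    with w show ?thesis by blast
  qed
  show g: "(\<lambda>k. b k * z ^ k) sums g z" if z: "norm z < 1" for z
  proof (cases "z = 0")
    case True
    then show ?thesis by (simp add: g_def powser_sums_zero)
  next
    case False
    obtain w where w: "w ^ p = z" "norm w < 1" using root[OF z] by blast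
    have "w \<noteq> 0" using w(1) False p by auto
    have "(\<lambda>k. b k * w ^ (p * k + m) / w ^ m) sums (f w / w ^ m)"
      by (intro sums_divide f w)
    then have "(\<lambda>k. b k * z ^ k) sums (f w / w ^ m)"
      using \<open>w \<noteq> 0\<close> by (simp add: power_add power_mult w(1))
    then show ?thesis by (simp add: g_def sums_iff)
  qed
  show fg: "f z = z ^ m * g (z ^ p)" if z: "norm z < 1" for z
  proof -
    have "norm (z ^ p) < 1"
      using z p by (simp add: norm_power power_less_one_iff)
    then have "(\<lambda>k. z ^ m * (b k * (z ^ p) ^ k)) sums (z ^ m * g (z ^ p))"
      by (intro sums_mult g)
    moreover have "z ^ m * (b k * (z ^ p) ^ k) = b k * z ^ (p * k + m)" for k
      by (simp add: power_add power_mult)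
    ultimately have "(\<lambda>k. b k * z ^ (p * k + m)) sums (z ^ m * g (z ^ p))"
      by simp
    with f[OF z] show ?thesis
      by (rule sums_unique2)
  qed
  have hol: "g holomorphic_on ball 0 1"
    by (rule power_series_on_unit_disk(1)[OF g])
  have circle: "norm (g z) \<le> 1 / norm z" if z: "0 < norm z" "norm z < 1" for z
  proof -
    obtain w where w: "w ^ p = z" "norm w < 1" "norm w ^ p = norm z" using root z by blast
    have "norm (f w) \<le> 1"
      using w(2) le by (simp add: image_subset_iff)
    then have "norm (w ^ m * g z) \<le> 1"
      by (simp only: fg[OF w(2)] w(1))
    moreover have "norm z \<le> norm w ^ m"
      using w p by (metis less_imp_le norm_ge_zero power_decreasing)
    ultimately have "norm z * norm (g z) \<le> 1"
      by (simp add: norm_mult norm_power) (meson dual_order.trans mult_right_mono norm_ge_zero)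
    with z show ?thesis
      by (simp add: field_simps)
  qed
  have "norm (g z) \<le> 1" if z: "norm z < 1" for z
  proof (rule ccontr)
    assume "\<not> norm (g z) \<le> 1"
    then have gt: "1 < norm (g z)" by simp
    then have "1 / norm (g z) < 1"
      by (subst divide_less_eq_1_pos) linarith+
    then have "max (norm z) (1 / norm (g z)) < 1"
      using z by simp
    then obtain t where t: "norm z < t" "1 / norm (g z) < t" "t < 1"
      using dense[of "max (norm z) (1 / norm (g z))" 1] by auto
    then have t0: "0 < t"
      using norm_ge_zero[of z] by linarith
    \<comment> \<open>By the choice of \<open>t\<close> this bound is below \<open>norm (g z)\<close>.\<close>
    have "norm (g z) \<le> 1 / t"
    proof (rule maximum_modulus_frontier[of g "ball 0 t"])
      show "g holomorphic_on interior (ball 0 t)"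
        using t by (auto intro: holomorphic_on_subset[OF hol])
      show "continuous_on (closure (ball 0 t)) g"
        using t t0 by (intro continuous_on_subset[OF holomorphic_on_imp_continuous_on[OF hol]]) auto
      show "norm (g \<zeta>) \<le> 1 / t" if "\<zeta> \<in> frontier (ball 0 t)" for \<zeta>
        using that circle[of \<zeta>] t t0 by auto
    qed (use t in auto)
    then have "norm (g z) * t \<le> 1"
      using t0 by (simp add: field_simps)
    moreover have "1 < t * norm (g z)"
      using t(2) gt pos_divide_less_eq[of "norm (g z)" 1 t] by linarith
    ultimately show False
      by (simp add: mult.commute)
  qed
  then show "g ` ball 0 1 \<subseteq> cball 0 1"
    by (simp add: image_subset_iff)
qed

lemma bohr_class_lacunary_factor:
  assumes p: "1 \<le> p" "m \<le> p" and f: "f \<in> bohr_class p m"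
  obtains b g where "\<forall>z. norm z < 1 \<longrightarrow> (\<lambda>k. b k * z ^ k) sums g z"
    and "\<forall>z. norm z < 1 \<longrightarrow> f z = z ^ m * g (z ^ p)"
    and "g ` ball 0 1 \<subseteq> cball 0 1"
    and "\<forall>r M. (\<lambda>k. norm (b k) * (r ^ p) ^ k) sums M \<longrightarrow>
           (\<lambda>n. norm (fps_nth (fps_expansion f 0) n) * r ^ n) sums (r ^ m * M)"
proof -
  obtain a :: "nat \<Rightarrow> complex" where a: "\<forall>z\<in>ball 0 1. (\<lambda>k. a (p * k + m) * z ^ (p * k + m)) sums f z"
    using f by (auto simp: bohr_class_def)
  have le: "f ` ball 0 1 \<subseteq> cball 0 1"
    using f by (auto simp: bohr_class_def)
  define b where "b = (\<lambda>k. a (p * k + m))"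
  have sums: "(\<lambda>k. b k * z ^ (p * k + m)) sums f z" if "norm z < 1" for z
    using a that by (simp add: b_def)
  show ?thesis
  proof (rule that[of b "\<lambda>z. \<Sum>k. b k * z ^ k"]; (intro allI impI)?)
    show "(\<lambda>k. b k * z ^ k) sums (\<Sum>k. b k * z ^ k)" if "norm z < 1" for z
      by (rule lacunary_factor(1)[OF p _ le]) (fact sums that)+
    show "f z = z ^ m * (\<Sum>k. b k * (z ^ p) ^ k)" if "norm z < 1" for z
      by (rule lacunary_factor(2)[OF p _ le]) (fact sums that)+
    show "(\<lambda>z. \<Sum>k. b k * z ^ k) ` ball 0 1 \<subseteq> cball 0 1"
      by (rule lacunary_factor(3)[OF p _ le]) (fact sums)
    fix r :: real and M assume "(\<lambda>k. norm (b k) * (r ^ p) ^ k) sums M"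
    then have "(\<lambda>k. r ^ m * (norm (b k) * (r ^ p) ^ k)) sums (r ^ m * M)"
      by (rule sums_mult)
    moreover have "r ^ m * (norm (b k) * (r ^ p) ^ k) = norm (b k) * r ^ (p * k + m)" for k
      by (simp add: power_add power_mult)
    ultimately have "(\<lambda>k. norm (b k) * r ^ (p * k + m)) sums (r ^ m * M)"
      by simp
    then show "(\<lambda>n. norm (fps_nth (fps_expansion f 0) n) * r ^ n) sums (r ^ m * M)"
      by (subst majorant_sums_lacunary[OF p(1)]) (rule sums)
  qed
qed

section \<open>Bohr inequality, extremal function and uniqueness\<close>

text \<open>
  The majorant has nonnegative coefficients, so only \<open>r = bohr_root p m\<close> matters. There the
  factor \<open>r ^ m\<close> turns the bound \<open>s / \<rho>\<close> of the coefficient sum into one.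
\<close>

lemma bohr_class_majorant_at_root:
  assumes p: "1 \<le> p" "m \<le> p" and f: "f \<in> bohr_class p m"
    and r: "0 \<le> r" "r \<le> bohr_root p m"
  shows "summable (\<lambda>k. norm (fps_nth (fps_expansion f 0) k) * r ^ k)" and "majorant f r \<le> 1"
proof -
  let ?R = "bohr_root p m" and ?c = "\<lambda>k. norm (fps_nth (fps_expansion f 0) k)"
  note root = bohr_root_properties[OF p]
  have hol: "f holomorphic_on ball 0 1"
    using f by (simp add: bohr_class_def)
  obtain b g where "\<forall>z. norm z < 1 \<longrightarrow> (\<lambda>k. b k * z ^ k) sums g z"
    and g2: "g ` ball 0 1 \<subseteq> cball 0 1"
    and fg: "\<forall>z. norm z < 1 \<longrightarrow> f z = z ^ m * g (z ^ p)"
    and maj: "\<forall>r M. (\<lambda>k. norm (b k) * (r ^ p) ^ k) sums M \<longrightarrow> (\<lambda>n. ?c n * r ^ n) sums (r ^ m * M)"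
    by (rule bohr_class_lacunary_factor[OF p f]) blast
  then have g1: "\<And>z. norm z < 1 \<Longrightarrow> (\<lambda>k. b k * z ^ k) sums g z"
    by blast
  note g = g1 g2 and maj = maj[rule_format]
  have "0 < ?R ^ p"
    using root(1) by simp
  note T = coeff_sum_le_bohr[OF g this root(4-6)]
  have "majorant f ?R = ?R ^ m * (\<Sum>k. norm (b k) * (?R ^ p) ^ k)"
    unfolding majorant_def by (rule sums_unique[symmetric]) (rule maj[OF summable_sums[OF T(1)]])
  also have "\<dots> \<le> ?R ^ m * (?R ^ (p - m) / ?R ^ p)"
    using root(1) T(2) by (intro mult_left_mono) auto
  finally have R: "majorant f ?R \<le> 1"
    unfolding root(7) .
  show summ: "summable (\<lambda>k. ?c k * r ^ k)"
    by (rule summable_majorant[OF hol]) (use r root(2) in auto)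
  have "majorant f r \<le> majorant f ?R"
    unfolding majorant_def using summ r root(1,2)
    by (intro suminf_le summable_majorant[OF hol] mult_left_mono power_mono) auto
  with R show "majorant f r \<le> 1" by simp
qed

text \<open>
  In terms of \<open>s = r ^ (p - m)\<close>, a parameter below one means \<open>(3 * s - 1) * (3 - s) > 0\<close>, that is
  \<open>s > 1 / 3\<close>. This holds because \<open>s > r ^ p \<ge> 1 / 3\<close> for \<open>m \<ge> 1\<close>.
\<close>

lemma extremal_param_bounds:
  assumes p: "1 \<le> p" "m \<le> p" "1 \<le> m"
  shows "0 < extremal_param p m" "extremal_param p m < 1"
proof -
  let ?\<rho> = "bohr_root p m ^ p" and ?s = "bohr_root p m ^ (p - m)"
  note root = bohr_root_properties[OF p(1,2)]
  have s: "1 / 3 < ?s" "?s \<le> 1"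
    using root(3,5) root(8)[OF p(3)] by linarith+
  have pos: "0 < ?\<rho>"
    using root(1) by simp
  have "0 < extremal_param p m * ?\<rho>"
    using root(9) s by simp
  then show "0 < extremal_param p m"
    using pos by (rule zero_less_mult_pos2)
  have "0 < (3 * ?s - 1) * (3 - ?s)"
    using s by (intro mult_pos_pos) auto
  then have "((1 + ?s) / 4)\<^sup>2 < ?\<rho>\<^sup>2"
    using root(6) by (simp add: power2_eq_square field_simps)
  then have "(1 + ?s) / 4 < ?\<rho>"
    by (rule power_less_imp_less_base) (use pos in simp)
  then have "extremal_param p m * ?\<rho> < 1 * ?\<rho>"
    using root(9) by simp
  then show "extremal_param p m < 1"
    using pos by (simp only: mult_less_cancel_right_pos)
qed

lemma moebius_sums:
  fixes a :: real and w :: complex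
  assumes "norm (of_real a * w) < 1"
  shows "(\<lambda>k. (if k = 0 then - of_real a else of_real ((1 - a\<^sup>2) * a ^ (k - 1))) * w ^ k) sums
           ((w - of_real a) / (1 - of_real a * w))"
proof -
  define t :: "nat \<Rightarrow> complex"
    where "t = (\<lambda>k. (if k = 0 then - of_real a else of_real ((1 - a\<^sup>2) * a ^ (k - 1))) * w ^ k)"
  have "1 - of_real a * w \<noteq> 0"
    using assms by auto
  have "(\<lambda>k. of_real (1 - a\<^sup>2) * w * (of_real a * w) ^ k) sums (of_real (1 - a\<^sup>2) * w * (1 / (1 - of_real a * w)))"
    by (intro sums_mult geometric_sums assms)
  then have "(\<lambda>k. t (Suc k)) sums (of_real (1 - a\<^sup>2) * w * (1 / (1 - of_real a * w)))"
    by (simp add: t_def power_mult_distrib mult_ac)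
  then have "t sums (of_real (1 - a\<^sup>2) * w * (1 / (1 - of_real a * w)) + t 0)"
    by (rule sums_Suc)
  also have "of_real (1 - a\<^sup>2) * w * (1 / (1 - of_real a * w)) + t 0 = (w - of_real a) / (1 - of_real a * w)"
    using \<open>1 - of_real a * w \<noteq> 0\<close> by (simp add: t_def field_simps power2_eq_square)
  finally show ?thesis
    by (simp only: t_def)
qed

text \<open>
  The parameter is the zero of the perfect square in the gap formula, so the majorant is
  exactly one at the root. Beyond the root it exceeds one, since \<open>r ^ m\<close> strictly increases for
  \<open>m \<ge> 1\<close>.
\<close>

lemma extremal_fun_extremal:
  assumes p: "1 \<le> p" "m \<le> p" "1 \<le> m"
  shows "extremal p m (extremal_fun p m)"
proof -
  let ?R = "bohr_root p m" and ?F = "extremal_fun p m"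
  define a where "a = extremal_param p m"
  define b :: "nat \<Rightarrow> complex" where "b = (\<lambda>k. if k = 0 then - of_real a else of_real ((1 - a\<^sup>2) * a ^ (k - 1)))"
  note root = bohr_root_properties[OF p(1,2)]
  have a: "0 < a" "a < 1" "0 < 1 - a\<^sup>2"
    using extremal_param_bounds[OF p] by (auto simp: a_def power_less_one_iff)
  have zp: "norm (z ^ p) < 1" if "norm z < 1" for z :: complex
    using that p by (simp add: norm_power power_less_one_iff)
  have azp: "norm (of_real a * z ^ p) < 1" if "norm z < 1" for z :: complex
    using zp[OF that] a mult_strict_mono'[of a 1 "norm (z ^ p)" 1] by (simp add: norm_mult)
  have F: "?F z = z ^ m * ((z ^ p - of_real a) / (1 - of_real a * z ^ p))" for z
    by (simp add: extremal_fun_def a_def)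
  have sums: "(\<lambda>k. b k * z ^ (p * k + m)) sums ?F z" if z: "norm z < 1" for z
  proof -
    have "(\<lambda>k. z ^ m * (b k * (z ^ p) ^ k)) sums ?F z"
      unfolding F b_def by (intro sums_mult moebius_sums azp z)
    moreover have "z ^ m * (b k * (z ^ p) ^ k) = b k * z ^ (p * k + m)" for k
      by (simp add: power_add power_mult)
    ultimately show ?thesis by simp
  qed
  have "norm (?F z) \<le> 1" if z: "norm z < 1" for z
  proof -
    have "norm ((z ^ p - of_real a) / (1 - of_real a * z ^ p)) < 1"
      using Moebius_function_norm_lt_1[of "of_real a" "z ^ p" 0] zp[OF z] a by (simp add: Moebius_function_def)
    moreover have "norm (z ^ m) \<le> 1"
      using z by (simp add: norm_power power_le_one)
    ultimately show ?thesis
      unfolding F norm_mult by (intro mult_le_one) auto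
  qed
  moreover have "?F holomorphic_on ball 0 1"
    unfolding F[abs_def] by (intro holomorphic_intros) (use azp in fastforce)
  \<comment> \<open>The class indexes coefficients by exponent, so \<open>b\<close> is reindexed.\<close>
  moreover have "(\<lambda>k. b ((p * k + m - m) div p) * z ^ (p * k + m)) sums ?F z" if "norm z < 1" for z
    using sums[OF that] p by simp
  ultimately have cls: "?F \<in> bohr_class p m"
    unfolding bohr_class_def
    by (auto intro!: exI[of _ "\<lambda>n. b ((n - m) div p)"])
  have maj: "majorant ?F r = r ^ m * (a + r ^ p * (1 - a\<^sup>2) / (1 - a * r ^ p))" if r: "0 \<le> r" "r < 1" for r
  proof -
    have rp: "a * r ^ p < 1" "0 \<le> a * r ^ p"
      using azp[of "of_real r"] a r by (auto simp: norm_mult norm_power)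
    have "(\<lambda>k. (1 - a\<^sup>2) * r ^ p * (a * r ^ p) ^ k) sums ((1 - a\<^sup>2) * r ^ p * (1 / (1 - a * r ^ p)))"
      using rp by (intro sums_mult geometric_sums) simp
    moreover have "norm (b (Suc k)) * (r ^ p) ^ Suc k = (1 - a\<^sup>2) * r ^ p * (a * r ^ p) ^ k" for k
      unfolding b_def using a by (simp add: norm_mult norm_power power_mult_distrib del: of_real_mult of_real_power)
    ultimately have "(\<lambda>k. norm (b (Suc k)) * (r ^ p) ^ Suc k) sums ((1 - a\<^sup>2) * r ^ p * (1 / (1 - a * r ^ p)))"
      by (simp only:)
    then have "(\<lambda>k. norm (b k) * (r ^ p) ^ k) sums ((1 - a\<^sup>2) * r ^ p * (1 / (1 - a * r ^ p)) + norm (b 0) * (r ^ p) ^ 0)"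
      by (rule sums_Suc)
    then have "(\<lambda>k. r ^ m * (norm (b k) * (r ^ p) ^ k)) sums (r ^ m * (a + r ^ p * (1 - a\<^sup>2) / (1 - a * r ^ p)))"
      using a by (intro sums_mult) (simp add: b_def add.commute mult.commute)
    moreover have "r ^ m * (norm (b k) * (r ^ p) ^ k) = norm (b k) * r ^ (p * k + m)" for k
      by (simp add: power_add power_mult)
    ultimately have "(\<lambda>k. norm (b k) * r ^ (p * k + m)) sums (r ^ m * (a + r ^ p * (1 - a\<^sup>2) / (1 - a * r ^ p)))"
      by simp
    then have "(\<lambda>n. norm (fps_nth (fps_expansion ?F 0) n) * r ^ n) sums (r ^ m * (a + r ^ p * (1 - a\<^sup>2) / (1 - a * r ^ p)))"
      using majorant_sums_lacunary[OF p(1) sums] by blast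
    then show ?thesis
      unfolding majorant_def by (rule sums_unique[symmetric])
  qed
  have majR: "?R ^ m * (a + ?R ^ p * (1 - a\<^sup>2) / (1 - a * ?R ^ p)) = 1"
  proof -
    have \<rho>: "0 < ?R ^ p" and a\<rho>: "a * ?R ^ p < 1" and opt: "a * ?R ^ p - (1 + ?R ^ (p - m)) / 4 = 0"
      using root(1,5,9) by (auto simp: a_def)
    then have "a + ?R ^ p * (1 - a\<^sup>2) / (1 - a * ?R ^ p) = ?R ^ (p - m) / ?R ^ p"
      using moebius_majorant_gap[OF \<rho> a\<rho> root(6)] unfolding opt by simp
    then show ?thesis
      by (simp only: root(7))
  qed
  have gt_1: "majorant ?F r > 1" if r: "?R < r" "r < 1" for r
  proof -
    define H where "H x = a + x * (1 - a\<^sup>2) / (1 - a * x)" for x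
    have x: "?R ^ p \<le> r ^ p" "0 < ?R ^ p" "a * r ^ p < 1"
      using r root(1) azp[of "of_real r"] a by (auto intro: power_mono simp: norm_mult norm_power)
    have "a * ?R ^ p \<le> a * r ^ p"
      using a x(1) by (intro mult_left_mono) auto
    with x(3) have ax: "a * ?R ^ p \<le> a * r ^ p" "a * ?R ^ p < 1"
      by linarith+
    then have "H (?R ^ p) \<le> H (r ^ p)"
      using x a unfolding H_def by (intro add_left_mono frac_le mult_right_mono) auto
    moreover have "H (?R ^ p) > 0"
      using x a ax unfolding H_def by (intro add_pos_pos divide_pos_pos mult_pos_pos) auto
    moreover have "?R ^ m < r ^ m"
      using r root(1) p by (intro power_strict_mono) auto
    ultimately have "?R ^ m * H (?R ^ p) < r ^ m * H (r ^ p)"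
      using root(1) by (intro mult_less_le_imp_less) auto
    then show ?thesis
      using majR maj[of r] r root(1) by (simp add: H_def)
  qed
  have "\<not> ?R < bohr_radius ?F"
  proof
    assume "?R < bohr_radius ?F"
    then obtain r where r: "?R < r" "r < bohr_radius ?F"
      using dense by blast
    then have "r < 1"
      using bohr_radius_greatest(2)[of ?F] by simp
    then show False
      using gt_1[of r] bohr_radius_greatest(3)[of r ?F] r root(1) by simp
  qed
  moreover have "?R \<le> bohr_radius ?F"
    using bohr_class_majorant_at_root(2)[OF p(1,2) cls] root(1,2)
    by (intro bohr_radius_greatest(4)) auto
  ultimately have "bohr_radius ?F = ?R"
    by simp
  with cls show ?thesis
    by (simp add: extremal_def)
qed

text \<open>
  An extremal \<open>f\<close> has majorant one at the root, so every estimate above is an equality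
  for the factor \<open>g\<close>: its constant coefficient has the extremal modulus and its derivative at
  the origin is the largest that Schwarz-Pick allows. Hence \<open>g\<close> is a Moebius map. For \<open>m = 0\<close> the
  extremal parameter is one, while nonconstant \<open>g\<close> has \<open>norm (b 0) < 1\<close> and constants
  have Bohr radius one, so in that case no function is extremal.
\<close>

lemma extremal_imp_rotation:
  assumes p: "1 \<le> p" "m \<le> p" and ext: "extremal p m f"
  obtains c d :: complex where "norm c = 1" "norm d = 1"
    "\<And>z. norm z < 1 \<Longrightarrow> f z = c * extremal_fun p m (d * z)"
proof -
  let ?R = "bohr_root p m" and ?c = "\<lambda>k. norm (fps_nth (fps_expansion f 0) k)"
  define a where "a = extremal_param p m"
  note root = bohr_root_properties[OF p]
  have f: "f \<in> bohr_class p m" and rad: "bohr_radius f = ?R"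
    using ext by (auto simp: extremal_def)
  have hol: "f holomorphic_on ball 0 1"
    using f by (simp add: bohr_class_def)
  note le_1 = bohr_class_majorant_at_root(2)[OF p f]
  have maj_R: "majorant f ?R = 1"
    using bohr_radius_gt[OF hol _ root(2) le_1] le_1[of ?R] root(1) rad by force
  obtain b g where "\<forall>z. norm z < 1 \<longrightarrow> (\<lambda>k. b k * z ^ k) sums g z"
    and g2: "g ` ball 0 1 \<subseteq> cball 0 1"
    and fg: "\<forall>z. norm z < 1 \<longrightarrow> f z = z ^ m * g (z ^ p)"
    and maj: "\<forall>r M. (\<lambda>k. norm (b k) * (r ^ p) ^ k) sums M \<longrightarrow> (\<lambda>n. ?c n * r ^ n) sums (r ^ m * M)"
    by (rule bohr_class_lacunary_factor[OF p f]) blast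
  then have g1: "\<And>z. norm z < 1 \<Longrightarrow> (\<lambda>k. b k * z ^ k) sums g z"
    by blast
  note g = g1 g2 and maj = maj[rule_format]
  have \<rho>: "0 < ?R ^ p"
    using root(1) by simp
  note T = coeff_sum_le_bohr[OF g \<rho> root(4-6)]
  have "norm (b 0) \<noteq> 1"
  proof
    assume b0: "norm (b 0) = 1"
    have "majorant f x \<le> 1" if x: "0 \<le> x" "x < 1" for x
    proof -
      have "norm (b k) * (x ^ p) ^ k = (if k = 0 then 1 else 0)" for k
        using constant_if_norm_coeff_0_eq_1[OF g b0, of k] b0 by auto
      then have "(\<lambda>k. norm (b k) * (x ^ p) ^ k) sums 1"
        using sums_single[of 0 "\<lambda>_. 1 :: real"] by simp
      then have "majorant f x = x ^ m * 1"
        unfolding majorant_def by (intro sums_unique[symmetric] maj)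
      with x show ?thesis by (simp add: power_le_one)
    qed
    then have "1 \<le> bohr_radius f"
      by (intro bohr_radius_greatest(4)) auto
    with rad root(2) show False by simp
  qed
  then have b0: "norm (b 0) < 1"
    using norm_coeff_0_le_1[OF g] by simp
  have "?R ^ m * (\<Sum>k. norm (b k) * (?R ^ p) ^ k) = 1"
    using maj_R sums_unique[OF maj[OF summable_sums[OF T(1)]]] by (simp add: majorant_def)
  then have "(\<Sum>k. norm (b k) * (?R ^ p) ^ k) = ?R ^ (p - m) / ?R ^ p"
    using root(1,7) by (metis mult_left_cancel power_not_zero less_irrefl)
  then have "norm (b 0) * ?R ^ p = (1 + ?R ^ (p - m)) / 4 \<and> norm (b 1) = 1 - (norm (b 0))\<^sup>2"
    by (intro T(3) b0)
  then have "norm (b 0) * ?R ^ p = a * ?R ^ p" and b1: "norm (b 1) = 1 - (norm (b 0))\<^sup>2"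
    unfolding a_def root(9) by blast+
  then have a: "norm (b 0) = a"
    using root(1) by simp
  have "0 < a * ?R ^ p"
    unfolding a_def root(9) using root(1) by (simp add: add_pos_pos)
  then have a0: "0 < a"
    using \<rho> by (rule zero_less_mult_pos2)
  have g0: "g 0 = b 0" and holg: "g holomorphic_on ball 0 1"
    using power_series_on_unit_disk[OF g(1)] by auto
  have "deriv g 0 = b 1"
    using fps_nth_fps_expansion[OF fps_expansion_of_sums(1)[OF g(1)], of 1] by simp
  then obtain \<alpha> where \<alpha>: "norm \<alpha> = 1"
    "\<And>z. norm z < 1 \<Longrightarrow> g z = (b 0 + \<alpha> * z) / (1 + cnj (b 0) * \<alpha> * z)"
    using schwarz_pick_equality[OF holg g(2)] b0 b1 unfolding g0 by metis
  \<comment> \<open>Rewriting the Moebius map with the real parameter \<open>a\<close> leaves the rotation \<open>D\<close> of the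
    variable \<open>z ^ p\<close>, hence a \<open>p\<close>-th root \<open>d\<close> of it for \<open>z\<close>.\<close>
  define \<beta> where "\<beta> = b 0 / of_real a"
  define D where "D = - cnj \<beta> * \<alpha>"
  have b0_eq: "b 0 = of_real a * \<beta>" and norm_\<beta>: "norm \<beta> = 1"
    using a a0 by (auto simp: \<beta>_def norm_divide)
  then have \<beta>: "\<beta> * cnj \<beta> = 1"
    by (simp flip: complex_norm_square)
  have norm_D: "norm D = 1"
    using \<alpha> norm_\<beta> by (simp add: D_def norm_mult)
  obtain d where d: "d ^ p = D" "norm d ^ p = norm D"
    using obtain_complex_root[of p D] p by auto
  then have norm_d: "norm d = 1"
    using p norm_D power_eq_iff_eq_base[of p "norm d" 1] by simp
  show ?thesis
  proof (rule that[of "- \<beta> / d ^ m" d])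
    show "norm (- \<beta> / d ^ m) = 1"
      using norm_\<beta> norm_d by (simp add: norm_divide norm_power)
    fix z :: complex assume z: "norm z < 1"
    have zp: "norm (z ^ p) < 1"
      using z p by (simp add: norm_power power_less_one_iff)
    have \<alpha>_eq: "\<alpha> = - (\<beta> * D)"
      unfolding D_def using \<beta> by (simp add: mult.assoc[symmetric])
    have "b 0 + \<alpha> * z ^ p = - \<beta> * (D * z ^ p - of_real a)"
      unfolding \<alpha>_eq b0_eq by (simp add: algebra_simps)
    moreover have "1 + cnj (b 0) * \<alpha> * z ^ p = 1 - of_real a * (D * z ^ p)"
      by (simp add: b0_eq D_def mult_ac)
    ultimately have "g (z ^ p) = - \<beta> * (D * z ^ p - of_real a) / (1 - of_real a * (D * z ^ p))"
      using \<alpha>(2)[OF zp] by simp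
    moreover have "d \<noteq> 0" using norm_d by auto
    ultimately show "f z = - \<beta> / d ^ m * extremal_fun p m (d * z)"
      using fg z by (simp add: extremal_fun_def power_mult_distrib d a_def)
  qed (use norm_d in simp)
qed

theorem theorem1:
  fixes p m :: nat
  assumes "p \<ge> 1" and "m \<le> p"
  shows "(0 < bohr_root p m \<and> bohr_root_eq p m (bohr_root p m) \<and>
            (\<forall>x>0. bohr_root_eq p m x \<longrightarrow> x \<le> bohr_root p m)) \<and>
         (\<forall>f\<in>bohr_class p m. \<forall>r. 0 \<le> r \<and> r \<le> bohr_root p m \<longrightarrow>
            summable (\<lambda>k. norm (fps_nth (fps_expansion f 0) k) * r ^ k) \<and> majorant f r \<le> 1) \<and>
         (m \<ge> 1 \<longrightarrow> extremal p m (extremal_fun p m)) \<and>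
         (\<forall>f. extremal p m f \<longrightarrow>
            (\<exists>c d :: complex. norm c = 1 \<and> norm d = 1 \<and>
               (\<forall>z\<in>ball 0 1. f z = c * extremal_fun p m (d * z))))"
proof (intro conjI ballI allI impI)
  show "0 < bohr_root p m" "bohr_root_eq p m (bohr_root p m)"
    using bohr_root_properties(1) bohr_root_greatest(1) assms by auto
  show "x \<le> bohr_root p m" if "0 < x" "bohr_root_eq p m x" for x
    by (rule bohr_root_greatest(3)[OF assms that])
  show "summable (\<lambda>k. norm (fps_nth (fps_expansion f 0) k) * r ^ k)" "majorant f r \<le> 1"
    if "f \<in> bohr_class p m" "0 \<le> r \<and> r \<le> bohr_root p m" for f r
    using bohr_class_majorant_at_root[OF assms that(1)] that(2) by auto
  show "extremal p m (extremal_fun p m)" if "1 \<le> m"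
    by (rule extremal_fun_extremal[OF assms that])
  show "\<exists>c d :: complex. norm c = 1 \<and> norm d = 1 \<and> (\<forall>z\<in>ball 0 1. f z = c * extremal_fun p m (d * z))"
    if "extremal p m f" for f
    by (rule extremal_imp_rotation[OF assms that]) auto
qed

end
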